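(* Let $\mathbf A,\mathbf b,\mathbf c$ describe an explicit $3$-stage Runge--Kutta scheme and let $\mathbf F^{[\nu]}\in\mathcal C^4$ for $\nu=1,\dots,N$. Then the corresponding MPRK scheme (see context, $s=3$) is at least of order $p=s=3$ if and only if $$\sigma_\mu=\big(\mathrm{NB}_2(\tfrac1\gamma,\mathbf y^n)\big)_\mu+\mathcal O(h^3),\quad \mu=1,\dots,N,$$ $$\sum_{i=2}^3 b_ic_i\frac{y^n_\nu+hc_iF_\nu(\mathbf y^n)}{\rho_{i\nu}}=\frac12+\mathcal O(h^2),\quad\nu=1,\dots,N,$$ $$\rho_{i\nu}=y^n_\nu+\mathcal O(h),\quad \nu=1,\dots,N,\ i=2,3.$$
   Context: All $\mathcal O$-statements are with respect to $h\to0$. MPRK scheme: applied to a production-destruction system $y_m'=\sum_{\nu=1}^N(p_{m\nu}(\mathbf y)-d_{m\nu}(\mathbf y))$, $m=1,\dots,N$, with $p_{m\nu}=d_{\nu m}$ and $p_{mm}=d_{mm}=0$, starting from a positive vector $\mathbf y^n\in\mathbb R^N$, it reads $$y^{(i)}_m=y^n_m+h\sum_{j=1}^{i-1}a_{ij}\sum_{\nu=1}^N\Big(p_{m\nu}(\mathbf y^{(j)})\frac{y^{(i)}_\nu}{\rho_{i\nu}}-d_{m\nu}(\mathbf y^{(j)})\frac{y^{(i)}_m}{\rho_{im}}\Big),\ i=1,\dots,s,\qquad y^{n+1}_m=y^n_m+h\sum_{j=1}^{s}b_{j}\sum_{\nu=1}^N\Big(p_{m\nu}(\mathbf y^{(j)})\frac{y^{n+1}_\nu}{\sigma_{\nu}}-d_{m\nu}(\mathbf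 y^{(j)})\frac{y^{n+1}_m}{\sigma_{m}}\Big),$$ $m=1,\dots,N$, where $\mathbf A=(a_{ij})$, $\mathbf b=(b_j)$ are the coefficients of the Runge--Kutta scheme and $c_i=\sum_j a_{ij}$. The coefficients are taken to be nonnegative without loss of generality: if $a_{ij}<0$ (or $b_j<0$), the weights are interchanged in the terms multiplied by that coefficient, i.e. the denominators $\rho_{i\nu}$ and $\rho_{im}$ (or $\sigma_\nu$ and $\sigma_m$) swap indices there, and the order conditions are the same. The Patankar-weight denominators $\rho_{i\nu}=\rho_{i\nu}(\mathbf y^n,\mathbf y^{(1)},\dots,\mathbf y^{(i-1)})$ ($i\ge2$) and $\sigma_\nu=\sigma_\nu(\mathbf y^n,\mathbf y^{(1)},\dots,\mathbf y^{(s)})$ are continuous functions of their arguments and positive for all $h\ge0$. $\mathbf F^{[\nu]}$ has components $F^{[\nu]}_m=p_{m\nu}$ for $\nu\neq m$ and $F^{[m]}_m=-\sum_{j}d_{mj}$, so the system is $\mathbf y'=\mathbf F(\mathbf y)=\sum_{\nu=1}^N\mathbf F^{[\nu]}(\mathbf y)$; $F_\nu$ is the $\nu$-th component of $\mathbf F$. All $\mathbf F^{[\nu]}$ are assumed to be Lipschitz continuous. Order at least $p$: whenever $\mathbf y^n=\mathbf y(t_n)$ for a solution $\mathbf y$, $\mathbf y^{n+1}=\mathbf y(t_n+h)+\mathcal O(h^{p+1})$; elementary differentials belonging to different colored rooted trees are regarded as linearly independent. $\mathrm{NB}_2(\tfrac1\gamma,\mathbf y)$ is the truncated NB-series of the exact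 solution over colored rooted trees with at most two nodes: $\mathrm{NB}_2(\tfrac1\gamma,\mathbf y)=\mathbf y+h\sum_{\mu}\mathbf F^{[\mu]}(\mathbf y)+\frac{h^2}{2}\sum_{\mu,\nu}\mathbf D\mathbf F^{[\mu]}(\mathbf y)\mathbf F^{[\nu]}(\mathbf y)=\mathbf y+h\mathbf F(\mathbf y)+\frac{h^2}{2}\mathbf D\mathbf F(\mathbf y)\mathbf F(\mathbf y)$, where $\mathbf D$ denotes the Jacobian.
   Formalization: The formal theorem additionally assumes that the underlying explicit 3-stage Runge–Kutta scheme is itself of order at least 3; without this the equivalence fails (e.g. replacing b by 2b and σ by 2σ leaves the step unchanged but violates the condition on σ). *)

theory Defs
  imports "HOL-Analysis.Analysis" "HOL-Library.Landau_Symbols"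
begin

definition pos_orthant :: "(real^'n::finite) set" where
  "pos_orthant = {y. \<forall>i. 0 < y $ i}"

text \<open>
  \<open>C_k k S f\<close>: \<open>f\<close> is \<open>k\<close> times continuously differentiable on the open set \<open>S\<close>. The
  recursion goes through directional derivatives so that the type of \<open>f\<close> does not change.
\<close>

primrec C_k :: "nat \<Rightarrow> 'a::real_normed_vector set \<Rightarrow> ('a \<Rightarrow> 'b::real_normed_vector) \<Rightarrow> bool" where
  "C_k 0 S f \<longleftrightarrow> continuous_on S f"
| "C_k (Suc k) S f \<longleftrightarrow> (\<forall>x\<in>S. f differentiable at x) \<and>
     (\<forall>v. C_k k S (\<lambda>x. frechet_derivative f (at x) v))"

definition lipschitz :: "'a::metric_space set \<Rightarrow> ('a \<Rightarrow> 'b::metric_space) \<Rightarrow> bool" where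
  "lipschitz S f \<longleftrightarrow> (\<exists>L. L-lipschitz_on S f)"

definition ode_solution ::
  "'a set \<Rightarrow> ('a::real_normed_vector \<Rightarrow> 'a) \<Rightarrow> (real \<Rightarrow> 'a) \<Rightarrow> real \<Rightarrow> real \<Rightarrow> bool" where
  "ode_solution S f y t0 T \<longleftrightarrow> 0 < T \<and>
     (\<forall>t\<in>{t0..t0 + T}. y t \<in> S \<and> (y has_vector_derivative f (y t)) (at t within {t0..t0 + T}))"


section \<open>Runge--Kutta schemes and additive schemes with step-size-dependent coefficients\<close>

text \<open>Stages are numbered from 1, as are the rows and columns of a tableau.\<close>

definition explicit_rk :: "nat \<Rightarrow> (nat \<Rightarrow> nat \<Rightarrow> real) \<Rightarrow> (nat \<Rightarrow> real) \<Rightarrow> bool" where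
  "explicit_rk s A c \<longleftrightarrow> (\<forall>i\<in>{1..s}. \<forall>j\<in>{i..s}. A i j = 0) \<and>
     (\<forall>i\<in>{1..s}. c i = (\<Sum>j=1..s. A i j))"

text \<open>
  One step of an explicit additive scheme for the split system \<open>u' = (\<Sum>\<nu>. G \<nu> u)\<close>, with
  its own coefficients \<open>\<alpha> i j \<nu>\<close>, \<open>\<beta> j \<nu>\<close> for each part; \<open>U i\<close> are the stages and
  \<open>w\<close> is the new value.
\<close>

definition additive_step ::
  "nat \<Rightarrow> (nat \<Rightarrow> nat \<Rightarrow> 'n \<Rightarrow> real) \<Rightarrow> (nat \<Rightarrow> 'n \<Rightarrow> real) \<Rightarrow> ('n::finite \<Rightarrow> real^'n \<Rightarrow> real^'n) \<Rightarrow>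
   real^'n \<Rightarrow> real \<Rightarrow> (nat \<Rightarrow> real^'n) \<Rightarrow> real^'n \<Rightarrow> bool" where
  "additive_step s \<alpha> \<beta> G u h U w \<longleftrightarrow>
     (\<forall>i\<in>{1..s}. U i = u + h *\<^sub>R (\<Sum>j=1..<i. \<Sum>\<nu>\<in>UNIV. \<alpha> i j \<nu> *\<^sub>R G \<nu> (U j))) \<and>
     w = u + h *\<^sub>R (\<Sum>j=1..s. \<Sum>\<nu>\<in>UNIV. \<beta> j \<nu> *\<^sub>R G \<nu> (U j))"

text \<open>
  Order at least \<open>q\<close> of an additive scheme whose coefficients are given functions of the step
  size \<open>h\<close> (the first argument of \<open>\<alpha>\<close> and \<open>\<beta>\<close>), over all sufficiently smooth split systems.
\<close>

definition additive_order_at_least ::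
  "nat \<Rightarrow> nat \<Rightarrow> (real \<Rightarrow> nat \<Rightarrow> nat \<Rightarrow> 'n \<Rightarrow> real) \<Rightarrow> (real \<Rightarrow> nat \<Rightarrow> 'n::finite \<Rightarrow> real) \<Rightarrow> bool" where
  "additive_order_at_least s q \<alpha> \<beta> \<longleftrightarrow>
     (\<forall>(G :: 'n \<Rightarrow> real^'n \<Rightarrow> real^'n) u tn T U w.
        (\<forall>\<nu>. C_k (q + 1) UNIV (G \<nu>) \<and> lipschitz UNIV (G \<nu>)) \<longrightarrow>
        ode_solution UNIV (\<lambda>x. \<Sum>\<nu>\<in>UNIV. G \<nu> x) u tn T \<longrightarrow>
        (\<forall>\<^sub>F h in at_right 0. additive_step s (\<alpha> h) (\<beta> h) G (u tn) h (U h) (w h)) \<longrightarrow>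
        (\<lambda>h. norm (w h - u (tn + h))) \<in> O[at_right 0](\<lambda>h. h ^ (q + 1)))"

text \<open>
  A Runge--Kutta scheme is the case where every part gets the same constant coefficients: only
  \<open>f = (\<Sum>\<nu>. G \<nu>)\<close> then enters the step. The type argument fixes the dimension of the systems.
\<close>

definition rk_order_at_least ::
  "'n::finite itself \<Rightarrow> nat \<Rightarrow> nat \<Rightarrow> (nat \<Rightarrow> nat \<Rightarrow> real) \<Rightarrow> (nat \<Rightarrow> real) \<Rightarrow> bool" where
  "rk_order_at_least _ s q A b \<longleftrightarrow>
     additive_order_at_least s q (\<lambda>h i j (\<nu>::'n). A i j) (\<lambda>h j (\<nu>::'n). b j)"


section \<open>Production-destruction systems and MPRK schemes\<close>

definition pds ::
  "('n::finite \<Rightarrow> 'n \<Rightarrow> real^'n \<Rightarrow> real) \<Rightarrow> ('n \<Rightarrow> 'n \<Rightarrow> real^'n \<Rightarrow> real) \<Rightarrow> bool" where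
  "pds p d \<longleftrightarrow> (\<forall>y\<in>pos_orthant. \<forall>m.
     (\<forall>\<nu>. p m \<nu> y = d \<nu> m y) \<and> p m m y = 0 \<and> d m m y = 0)"

definition pds_part ::
  "('n::finite \<Rightarrow> 'n \<Rightarrow> real^'n \<Rightarrow> real) \<Rightarrow> ('n \<Rightarrow> 'n \<Rightarrow> real^'n \<Rightarrow> real) \<Rightarrow> 'n \<Rightarrow> real^'n \<Rightarrow> real^'n" where
  "pds_part p d \<nu> y = (\<chi> m. if m = \<nu> then - (\<Sum>j\<in>UNIV. d m j y) else p m \<nu> y)"

definition pds_rhs ::
  "('n::finite \<Rightarrow> 'n \<Rightarrow> real^'n \<Rightarrow> real) \<Rightarrow> ('n \<Rightarrow> 'n \<Rightarrow> real^'n \<Rightarrow> real) \<Rightarrow> real^'n \<Rightarrow> real^'n" where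
  "pds_rhs p d y = (\<Sum>\<nu>\<in>UNIV. pds_part p d \<nu> y)"

definition NB2 ::
  "('n::finite \<Rightarrow> 'n \<Rightarrow> real^'n \<Rightarrow> real) \<Rightarrow> ('n \<Rightarrow> 'n \<Rightarrow> real^'n \<Rightarrow> real) \<Rightarrow> real \<Rightarrow> real^'n \<Rightarrow> real^'n" where
  "NB2 p d h y = y + h *\<^sub>R (\<Sum>\<mu>\<in>UNIV. pds_part p d \<mu> y) +
     (h\<^sup>2 / 2) *\<^sub>R (\<Sum>\<mu>\<in>UNIV. \<Sum>\<nu>\<in>UNIV.
        frechet_derivative (pds_part p d \<mu>) (at y) (pds_part p d \<nu> y))"

text \<open>
  A Patankar-weight denominator \<open>g y Y\<close>, where \<open>y\<close> is the old value and \<open>Y j\<close> is the \<open>j\<close>-th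
  stage, that depends on the stages \<open>1, \<dots>, k\<close> only. Because of this, continuity in the product
  topology on \<open>Y\<close> is continuity in these \<open>k\<close> stages.
\<close>

definition patankar_denominator ::
  "nat \<Rightarrow> (real^'n::finite \<Rightarrow> (nat \<Rightarrow> real^'n) \<Rightarrow> real) \<Rightarrow> bool" where
  "patankar_denominator k g \<longleftrightarrow>
     (\<forall>y Y Y'. (\<forall>j\<in>{1..k}. Y j = Y' j) \<longrightarrow> g y Y = g y Y') \<and>
     continuous_on {(y, Y). y \<in> pos_orthant \<and> (\<forall>j\<in>{1..k}. Y j \<in> pos_orthant)} (\<lambda>(y, Y). g y Y) \<and>
     (\<forall>y\<in>pos_orthant. \<forall>Y. (\<forall>j\<in>{1..k}. Y j \<in> pos_orthant) \<longrightarrow> 0 < g y Y)"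

text \<open>
  \<open>Y\<close> and \<open>z\<close> are stages and new value of an MPRK step of size \<open>h\<close> from \<open>y\<close> (for nonnegative
  coefficients). The equations are linearly implicit; they determine \<open>Y 1, \<dots>, Y s\<close> and \<open>z\<close>
  uniquely when \<open>h\<close> is small.
\<close>

definition mprk_step ::
  "nat \<Rightarrow> (nat \<Rightarrow> nat \<Rightarrow> real) \<Rightarrow> (nat \<Rightarrow> real) \<Rightarrow>
   ('n::finite \<Rightarrow> 'n \<Rightarrow> real^'n \<Rightarrow> real) \<Rightarrow> ('n \<Rightarrow> 'n \<Rightarrow> real^'n \<Rightarrow> real) \<Rightarrow>
   (nat \<Rightarrow> 'n \<Rightarrow> real^'n \<Rightarrow> (nat \<Rightarrow> real^'n) \<Rightarrow> real) \<Rightarrow>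
   ('n \<Rightarrow> real^'n \<Rightarrow> (nat \<Rightarrow> real^'n) \<Rightarrow> real) \<Rightarrow>
   real^'n \<Rightarrow> real \<Rightarrow> (nat \<Rightarrow> real^'n) \<Rightarrow> real^'n \<Rightarrow> bool" where
  "mprk_step s A b p d \<rho> \<sigma> y h Y z \<longleftrightarrow>
     (\<forall>i\<in>{1..s}. \<forall>m. Y i $ m = y $ m + h * (\<Sum>j=1..<i. A i j * (\<Sum>\<nu>\<in>UNIV.
        p m \<nu> (Y j) * (Y i $ \<nu> / \<rho> i \<nu> y Y) - d m \<nu> (Y j) * (Y i $ m / \<rho> i m y Y)))) \<and>
     (\<forall>m. z $ m = y $ m + h * (\<Sum>j=1..s. b j * (\<Sum>\<nu>\<in>UNIV.
        p m \<nu> (Y j) * (z $ \<nu> / \<sigma> \<nu> y Y) - d m \<nu> (Y j) * (z $ m / \<sigma> m y Y))))"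

text \<open>
  An MPRK step is the additive step for \<open>pds_part p d\<close> with coefficients
  \<open>A i j * (Y i $ \<nu> / \<rho> i \<nu>)\<close> and \<open>b j * (z $ \<nu> / \<sigma> \<nu>)\<close>. The first conjunct of the definition
  below is the local error bound for the production-destruction system itself. A single system
  does not separate the elementary differentials of the coloured rooted trees (if it is zero,
  every scheme is exact). That they count as linearly independent is the second conjunct: with the
  coefficients kept as functions of \<open>h\<close>, the local error bound must not rely on relations between
  the elementary differentials of the particular parts, so it holds with arbitrary parts \<open>G \<nu>\<close>
  in place of \<open>pds_part p d \<nu>\<close>.
\<close>

definition mprk_order_at_least ::
  "nat \<Rightarrow> nat \<Rightarrow> (nat \<Rightarrow> nat \<Rightarrow> real) \<Rightarrow> (nat \<Rightarrow> real) \<Rightarrow>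
   ('n::finite \<Rightarrow> 'n \<Rightarrow> real^'n \<Rightarrow> real) \<Rightarrow> ('n \<Rightarrow> 'n \<Rightarrow> real^'n \<Rightarrow> real) \<Rightarrow>
   (nat \<Rightarrow> 'n \<Rightarrow> real^'n \<Rightarrow> (nat \<Rightarrow> real^'n) \<Rightarrow> real) \<Rightarrow>
   ('n \<Rightarrow> real^'n \<Rightarrow> (nat \<Rightarrow> real^'n) \<Rightarrow> real) \<Rightarrow> bool" where
  "mprk_order_at_least s q A b p d \<rho> \<sigma> \<longleftrightarrow>
     (\<forall>yn\<in>pos_orthant. \<forall>Y z.
        (\<forall>\<^sub>F h in at_right 0. mprk_step s A b p d \<rho> \<sigma> yn h (Y h) (z h)) \<longrightarrow>
        (\<forall>y tn T. ode_solution pos_orthant (pds_rhs p d) y tn T \<longrightarrow> y tn = yn \<longrightarrow>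
           (\<lambda>h. norm (z h - y (tn + h))) \<in> O[at_right 0](\<lambda>h. h ^ (q + 1))) \<and>
        additive_order_at_least s q
          (\<lambda>h i j \<nu>. A i j * (Y h i $ \<nu> / \<rho> i \<nu> yn (Y h)))
          (\<lambda>h j \<nu>. b j * (z h $ \<nu> / \<sigma> \<nu> yn (Y h))))"

end

theory Submission
  imports Defs "HOL-Real_Asymp.Real_Asymp"
begin

text \<open>
  An MPRK step is an additive Runge--Kutta step whose coefficients carry the Patankar weights
  \<open>w i \<nu> = Y i $ \<nu> / \<rho> i \<nu>\<close> and \<open>v \<nu> = z $ \<nu> / \<sigma> \<nu>\<close>. Testing the order on scalar equations (linear
  ones and \<open>y' = cos y\<close>) yields \<open>v \<nu> = 1 + O(h^3)\<close>, \<open>b2 c2 w2 + b3 c3 w3 = 1/2 + O(h^2)\<close>,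
  \<open>b2 c2^2 w2^2 + b3 c3^2 w3^2 = 1/3 + O(h)\<close> and \<open>w2 w3 = 1 + O(h)\<close>; together with the
  conditions on the underlying scheme and nonnegativity this forces \<open>w2\<close> and \<open>w3\<close> to tend to \<open>1\<close>.
  Conversely \<open>w i = 1 + O(h)\<close>, \<open>v = 1 + O(h^3)\<close> and the weighted sum condition suffice, by
  comparing the Taylor expansions of the step and of the exact solution. Since
  \<open>Y i = yn + h c i F(yn) + O(h^2)\<close> and \<open>z = NB2 + O(h^3)\<close>, the statements about the weights
  translate into the statements about the denominators; for \<open>\<sigma>\<close> the order of \<open>v - 1\<close> is raised from
  1 to 3 one step at a time, each gain improving the expansion of \<open>z\<close>.
\<close>

section \<open>Orders in the step size\<close>

text \<open>Since the coefficients vary with \<open>h\<close>, a local error bound cannot be sorted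
  by powers of \<open>h\<close>; necessity varies the rate \<open>l\<close> of the linear test
  equation instead. The tests see only products of a coefficient with its weights, so enlarging a
  row of \<open>A\<close> and shrinking its weights goes unnoticed; the conditions on the underlying
  scheme remove this freedom. Continuity of the denominators gives the weights limits but no rates:
  the limits come from algebra, the rate of the second stage from \<open>\<rho> 2\<close> being
  fixed by \<open>yn\<close>, that of the third from the product of both weights. Tests with a
  single colour suffice, because the conditions found for each colour separately already imply the
  full expansion for mixed colours.

  For sufficiency, \<open>W i = 1 + O(h)\<close> fixes a single stage only up to
  \<open>O(h^2)\<close>, one order less than an error \<open>O(h^4)\<close> calls for. At the
  critical order, however, the stages enter linearly, through the sum of
  \<open>b j * (U j - u)\<close>, in which the weights occur only as
  \<open>b2 c2 w2 + b3 c3 w3\<close>, and this combination is known up to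
  \<open>O(h^2)\<close>.\<close>

definition hO :: "nat \<Rightarrow> (real \<Rightarrow> 'a::real_normed_vector) \<Rightarrow> bool" where
  "hO k f \<longleftrightarrow> (\<lambda>h. norm (f h)) \<in> O[at_right 0](\<lambda>h. h ^ k)"

lemma hO_iff_bound: "hO k f \<longleftrightarrow> (\<exists>C>0. \<forall>\<^sub>F h in at_right 0. norm (f h) \<le> C * h ^ k)"
proof -
  have "(\<forall>\<^sub>F h in at_right (0::real). norm (norm (f h)) \<le> C * norm (h ^ k)) \<longleftrightarrow>
        (\<forall>\<^sub>F h in at_right 0. norm (f h) \<le> C * h ^ k)" for C
    by (intro eventually_cong eventually_mono[OF eventually_at_right_less[of 0]]) auto
  then show ?thesis
    unfolding hO_def bigo_def by auto
qed

lemma hO_real_iff: "hO k f \<longleftrightarrow> f \<in> O[at_right 0](\<lambda>h. h ^ k)" for f :: "real \<Rightarrow> real"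
  unfolding hO_def by simp

lemma hOI: "\<forall>\<^sub>F h in at_right 0. norm (f h) \<le> C * h ^ k \<Longrightarrow> hO k f"
  unfolding hO_iff_bound
proof (intro exI[of _ "max C 1"] conjI)
  assume *: "\<forall>\<^sub>F h in at_right 0. norm (f h) \<le> C * h ^ k"
  show "\<forall>\<^sub>F h in at_right 0. norm (f h) \<le> max C 1 * h ^ k"
    using * eventually_at_right_less[of 0]
  proof eventually_elim
    case (elim h)
    have "C * h ^ k \<le> max C 1 * h ^ k" using elim by (intro mult_right_mono) auto
    with elim show ?case by linarith
  qed
qed auto

lemma hOE:
  assumes "hO k f"
  obtains C where "C > 0" "\<forall>\<^sub>F h in at_right 0. norm (f h) \<le> C * h ^ k"
  using assms unfolding hO_iff_bound by blast

lemma hO_cong: "\<forall>\<^sub>F h in at_right 0. f h = g h \<Longrightarrow> hO k f \<longleftrightarrow> hO k g"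
  unfolding hO_def by (intro landau_o.big.in_cong) (auto elim: eventually_mono)

lemma hO_eqI: "hO k g \<Longrightarrow> \<forall>\<^sub>F h in at_right 0. f h = g h \<Longrightarrow> hO k f"
  using hO_cong by blast

lemma hO_zero [intro, simp]: "hO k (\<lambda>h. 0)"
  unfolding hO_def by simp

lemma hO_add [intro]: "hO k f \<Longrightarrow> hO k g \<Longrightarrow> hO k (\<lambda>h. f h + g h)"
  unfolding hO_def
  by (rule landau_o.big_trans[OF landau_o.bigI[of 1, where g = "\<lambda>h. norm (f h) + norm (g h)"]])
     (auto intro!: sum_in_bigo always_eventually order_trans[OF norm_triangle_ineq])

lemma hO_minus [intro]: "hO k f \<Longrightarrow> hO k (\<lambda>h. - f h)"
  unfolding hO_def by simp

lemma hO_diff [intro]: "hO k f \<Longrightarrow> hO k g \<Longrightarrow> hO k (\<lambda>h. f h - g h)"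
  using hO_add[of k f "\<lambda>h. - g h"] hO_minus[of k g] by simp

lemma hO_diff_swap: "hO k (\<lambda>h. f h - g h) \<Longrightarrow> hO k (\<lambda>h. g h - f h)"
  using hO_minus[of k "\<lambda>h. f h - g h"] by simp

lemma hO_trans: "hO k (\<lambda>h. f h - g h) \<Longrightarrow> hO k (\<lambda>h. g h - e h) \<Longrightarrow> hO k (\<lambda>h. f h - e h)"
  using hO_add[of k "\<lambda>h. f h - g h" "\<lambda>h. g h - e h"] by simp

lemma hO_sum [intro]: "(\<And>i. i \<in> I \<Longrightarrow> hO k (f i)) \<Longrightarrow> hO k (\<lambda>h. \<Sum>i\<in>I. f i h)"
  by (induction I rule: infinite_finite_induct) auto

lemma hO_prod:
  assumes "bounded_bilinear B" "hO k f" "hO l g"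
  shows "hO (k + l) (\<lambda>h. B (f h) (g h))"
proof -
  obtain K where K: "0 < K" "\<And>a b. norm (B a b) \<le> norm a * norm b * K"
    using bounded_bilinear.pos_bounded[OF assms(1)] by blast
  have "(\<lambda>h. norm (B (f h) (g h))) \<in> O[at_right 0](\<lambda>h. norm (f h) * norm (g h))"
    by (rule landau_o.bigI[of K]) (use K in \<open>auto simp: mult.commute\<close>)
  also have "(\<lambda>h. norm (f h) * norm (g h)) \<in> O[at_right 0](\<lambda>h. h ^ k * h ^ l)"
    using assms(2,3) unfolding hO_def by (rule landau_o.big.mult)
  finally show ?thesis
    unfolding hO_def by (simp add: power_add)
qed

lemma hO_linear:
  assumes "bounded_linear L" "hO k f"
  shows "hO k (\<lambda>h. L (f h))"
proof -
  obtain K where K: "0 < K" "\<And>a. norm (L a) \<le> norm a * K"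
    using bounded_linear.pos_bounded[OF assms(1)] by blast
  have "(\<lambda>h. norm (L (f h))) \<in> O[at_right 0](\<lambda>h. norm (f h))"
    by (rule landau_o.bigI[of K]) (use K in \<open>auto simp: mult.commute\<close>)
  also have "(\<lambda>h. norm (f h)) \<in> O[at_right 0](\<lambda>h. h ^ k)"
    using assms(2) unfolding hO_def .
  finally show ?thesis
    unfolding hO_def .
qed

lemma hO_scaleR: "hO k f \<Longrightarrow> hO l g \<Longrightarrow> hO (k + l) (\<lambda>h. f h *\<^sub>R g h)"
  by (rule hO_prod[OF bounded_bilinear_scaleR])

lemma hO_mult: "hO k f \<Longrightarrow> hO l g \<Longrightarrow> hO (k + l) (\<lambda>h. f h * g h)"
  for f g :: "real \<Rightarrow> real"
  by (rule hO_prod[OF bounded_bilinear_mult])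

lemma hO_norm: "hO k f \<Longrightarrow> hO k (\<lambda>h. norm (f h))"
  by (simp add: hO_def)

lemma hO_component: "hO k f \<Longrightarrow> hO k (\<lambda>h. f h $ i)"
  by (rule hO_linear[OF bounded_linear_vec_nth])

lemma hO_mono:
  assumes "hO k f" "l \<le> k"
  shows "hO l f"
proof -
  have "(\<lambda>h. h ^ k) \<in> O[at_right 0](\<lambda>h::real. h ^ l)"
  proof (rule landau_o.bigI[of 1])
    show "\<forall>\<^sub>F h in at_right (0::real). norm (h ^ k) \<le> 1 * norm (h ^ l)"
      using eventually_at_right_real[of 0 1]
      by (auto elim!: eventually_mono intro!: power_decreasing simp: assms(2))
  qed simp
  with assms(1) show ?thesis
    unfolding hO_def using landau_o.big_trans by blast
qed

lemma hO_const [intro, simp]: "hO 0 (\<lambda>h. c)"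
  unfolding hO_def by simp

lemma hO_power [intro, simp]: "hO k (\<lambda>h. h ^ k)"
  unfolding hO_def by (simp add: norm_power)

lemma hO_id [intro, simp]: "hO 1 (\<lambda>h. h)" "hO (Suc 0) (\<lambda>h. h)"
  using hO_power[of 1] by simp_all

lemma hO_cmult: "hO k f \<Longrightarrow> hO k (\<lambda>h. c * f h)" for f :: "real \<Rightarrow> real"
  using hO_mult[OF hO_const] by fastforce

lemma hO_cscale: "hO k f \<Longrightarrow> hO k (\<lambda>h. c *\<^sub>R f h)"
  using hO_scaleR[OF hO_const] by fastforce

lemma hO_mult_bounded: "hO k f \<Longrightarrow> hO 0 g \<Longrightarrow> hO k (\<lambda>h. f h * g h)"
  for f g :: "real \<Rightarrow> real"
  using hO_mult[of k f 0 g] by simp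

lemma hO_shift: "hO k f \<Longrightarrow> hO (Suc k) (\<lambda>h. h *\<^sub>R f h)"
  using hO_scaleR[OF hO_id(1)] by fastforce

text \<open>Only \<open>h > 0\<close> counts for the filter \<open>at_right 0\<close>, so a power of
  \<open>h\<close> may be divided out at the cost of that many orders.\<close>

lemma hO_cancel:
  assumes "hO (l + k) (\<lambda>h. h ^ l *\<^sub>R f h)"
  shows "hO k f"
proof -
  obtain C where "\<forall>\<^sub>F h in at_right 0. norm (h ^ l *\<^sub>R f h) \<le> C * h ^ (l + k)"
    using assms by (rule hOE)
  with eventually_at_right_less[of 0] show ?thesis
    by (intro hOI[of _ C], eventually_elim) (simp add: power_add field_simps)
qed

lemma tendsto_imp_hO:
  assumes "(f \<longlongrightarrow> l) (at_right 0)"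
  shows "hO 0 f"
proof (rule hOI[of _ "norm l + 1"])
  have "\<forall>\<^sub>F h in at_right 0. norm (f h) < norm l + 1"
    using tendsto_norm[OF assms] by (rule order_tendstoD(2)) simp
  then show "\<forall>\<^sub>F h in at_right 0. norm (f h) \<le> (norm l + 1) * h ^ 0"
    by eventually_elim simp
qed

lemma hO_imp_tendsto_0:
  assumes "hO (Suc k) f"
  shows "(f \<longlongrightarrow> 0) (at_right 0)"
proof -
  obtain C where C: "\<forall>\<^sub>F h in at_right 0. norm (f h) \<le> C * h ^ 1"
    using hO_mono[OF assms, of 1] by (auto elim: hOE)
  have "((\<lambda>h. C * h ^ 1) \<longlongrightarrow> C * 0 ^ 1) (at_right (0::real))"
    by (intro tendsto_intros)
  with C show ?thesis
    by (intro Lim_null_comparison[of f]) auto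
qed

lemma hO_imp_tendsto: "hO (Suc k) (\<lambda>h. f h - l) \<Longrightarrow> (f \<longlongrightarrow> l) (at_right 0)"
  using hO_imp_tendsto_0 LIM_zero_cancel by blast

text \<open>A constant is its own limit. For coefficients independent of \<open>h\<close> this turns
  asymptotic order conditions into exact equations.\<close>

lemma hO_const_Suc_iff: "hO (Suc k) (\<lambda>h. c) \<longleftrightarrow> c = 0"
  by (metis hO_imp_tendsto_0 hO_zero tendsto_const tendsto_unique trivial_limit_at_right_real)

text \<open>Both \<open>g\<close> and its inverse stay bounded near a nonzero limit, so multiplying
  by either preserves the order. This is the bridge between weights and denominators.\<close>

lemma hO_quotient:
  fixes f g :: "real \<Rightarrow> real"
  assumes "(g \<longlongrightarrow> l) (at_right 0)" "l \<noteq> 0"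
  shows "hO k (\<lambda>h. f h / g h - 1) \<longleftrightarrow> hO k (\<lambda>h. f h - g h)"
proof -
  have g: "hO 0 g" "hO 0 (\<lambda>h. inverse (g h))"
    using assms by (auto intro!: tendsto_imp_hO tendsto_inverse)
  have nz: "\<forall>\<^sub>F h in at_right 0. g h \<noteq> 0"
    using assms by (rule tendsto_imp_eventually_ne)
  show ?thesis
  proof
    assume "hO k (\<lambda>h. f h / g h - 1)"
    then have "hO k (\<lambda>h. (f h / g h - 1) * g h)" using g(1) by (rule hO_mult_bounded)
    then show "hO k (\<lambda>h. f h - g h)"
      by (rule hO_eqI) (use nz in eventually_elim, simp add: field_simps)
  next
    assume "hO k (\<lambda>h. f h - g h)"
    then have "hO k (\<lambda>h. (f h - g h) * inverse (g h))" using g(2) by (rule hO_mult_bounded)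
    then show "hO k (\<lambda>h. f h / g h - 1)"
      by (rule hO_eqI) (use nz in eventually_elim, simp add: field_simps)
  qed
qed

section \<open>Taylor expansion\<close>

lemma C_k_imp_continuous_on: "C_k k S f \<Longrightarrow> continuous_on S f"
  by (cases k) (auto intro!: continuous_at_imp_continuous_on differentiable_imp_continuous_within)

lemma linear_eq_sum_Basis:
  fixes L :: "'a::euclidean_space \<Rightarrow> 'b::real_vector"
  assumes "linear L"
  shows "L x = (\<Sum>b\<in>Basis. (x \<bullet> b) *\<^sub>R L b)"
proof -
  have "L x = L (\<Sum>b\<in>Basis. (x \<bullet> b) *\<^sub>R b)"
    by (simp add: euclidean_representation)
  also have "\<dots> = (\<Sum>b\<in>Basis. (x \<bullet> b) *\<^sub>R L b)"
    by (simp only: linear_sum[OF assms] linear_cmul[OF assms])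
  finally show ?thesis .
qed

text \<open>Integrating along the segment from \<open>u\<close> to \<open>u + x\<close> raises the order of an expansion by
  one.\<close>

lemma expansion_step:
  fixes f :: "'a::euclidean_space \<Rightarrow> 'b::real_normed_vector"
  assumes S: "open S" "u \<in> S"
    and diff: "\<And>x. x \<in> S \<Longrightarrow> f differentiable at x"
    and P: "\<And>b. b \<in> Basis \<Longrightarrow>
      \<forall>\<^sub>F x in nhds 0. norm (frechet_derivative f (at (u + x)) b - P b x) \<le> C b * norm x ^ k"
    and R: "\<And>x t. ((\<lambda>t. R (t *\<^sub>R x)) has_vector_derivative
      (\<Sum>b\<in>Basis. (x \<bullet> b) *\<^sub>R P b (t *\<^sub>R x))) (at t)"
    and R0: "R 0 = f u"
  shows "\<exists>K. \<forall>\<^sub>F x in nhds 0. norm (f (u + x) - R x) \<le> K * norm x ^ Suc k"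
proof -
  have "\<forall>\<^sub>F x in nhds (0::'a). \<forall>b\<in>Basis.
      norm (frechet_derivative f (at (u + x)) b - P b x) \<le> C b * norm x ^ k"
    using P by (intro eventually_ball_finite) auto
  moreover have "\<forall>\<^sub>F x in nhds (0::'a). u + x \<in> S"
  proof -
    have "((\<lambda>x. u + x) \<longlongrightarrow> u + 0) (nhds 0)" by (intro tendsto_intros filterlim_ident)
    then show ?thesis using S by (auto dest: topological_tendstoD)
  qed
  ultimately have "\<forall>\<^sub>F x in nhds (0::'a). u + x \<in> S \<and> (\<forall>b\<in>Basis.
      norm (frechet_derivative f (at (u + x)) b - P b x) \<le> C b * norm x ^ k)"
    by eventually_elim auto
  then obtain \<delta> where \<delta>: "\<delta> > 0" and S': "\<And>x. norm x < \<delta> \<Longrightarrow> u + x \<in> S"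
    and P': "\<And>x b. norm x < \<delta> \<Longrightarrow> b \<in> Basis \<Longrightarrow>
      norm (frechet_derivative f (at (u + x)) b - P b x) \<le> C b * norm x ^ k"
    unfolding eventually_nhds_metric dist_norm by auto
  \<comment> \<open>The constants \<open>C b\<close> may be negative, hence the absolute
    values.\<close>
  define K where "K = (\<Sum>b\<in>(Basis::'a set). \<bar>C b\<bar>)"
  have "norm (f (u + x) - R x) \<le> K * norm x ^ Suc k" if x: "norm x < \<delta>" for x
  proof -
    \<comment> \<open>The gap vanishes at \<open>t = 0\<close> by \<open>R0\<close>, so a bound on
      its derivative controls it at \<open>t = 1\<close>.\<close>
    define g where "g t = f (u + t *\<^sub>R x) - R (t *\<^sub>R x)" for t
    define g' where "g' t = (\<Sum>b\<in>Basis. (x \<bullet> b) *\<^sub>R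
      (frechet_derivative f (at (u + t *\<^sub>R x)) b - P b (t *\<^sub>R x)))" for t
    have tx: "norm (t *\<^sub>R x) \<le> norm x" if "t \<in> {0..1}" for t
      using that by (simp add: mult_left_le_one_le)
    have der: "(g has_vector_derivative g' t) (at t)" if t: "t \<in> {0..1}" for t
    proof -
      let ?D = "frechet_derivative f (at (u + t *\<^sub>R x))"
      have D: "(f has_derivative ?D) (at (u + t *\<^sub>R x))"
        using diff[OF S'] tx[OF t] x by (metis frechet_derivative_works le_less_trans)
      then have lin: "linear ?D" by (rule has_derivative_linear)
      have "((\<lambda>t. f (u + t *\<^sub>R x)) has_vector_derivative ?D x) (at t)"
      proof -
        have "((\<lambda>t. u + t *\<^sub>R x) has_derivative (\<lambda>s. s *\<^sub>R x)) (at t)"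
          by (auto intro!: derivative_eq_intros)
        from has_derivative_compose[OF this, of f ?D] D show ?thesis
          by (simp add: has_vector_derivative_def linear_cmul[OF lin])
      qed
      moreover have "?D x = (\<Sum>b\<in>Basis. (x \<bullet> b) *\<^sub>R ?D b)"
        using lin by (rule linear_eq_sum_Basis)
      ultimately have "(g has_vector_derivative (\<Sum>b\<in>Basis. (x \<bullet> b) *\<^sub>R ?D b) -
          (\<Sum>b\<in>Basis. (x \<bullet> b) *\<^sub>R P b (t *\<^sub>R x))) (at t)"
        unfolding g_def using R by (intro has_vector_derivative_diff) auto
      then show ?thesis
        unfolding g'_def by (simp add: sum_subtractf scaleR_diff_right)
    qed
    have bound: "norm (g' t) \<le> K * norm x ^ Suc k" if t: "t \<in> {0..1}" for t
    proof -
      have "norm (g' t) \<le> (\<Sum>b\<in>Basis. norm x * (\<bar>C b\<bar> * norm x ^ k))"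
        unfolding g'_def
      proof (rule sum_norm_le)
        fix b :: 'a assume b: "b \<in> Basis"
        have "norm (frechet_derivative f (at (u + t *\<^sub>R x)) b - P b (t *\<^sub>R x))
            \<le> C b * norm (t *\<^sub>R x) ^ k"
          using P'[OF _ b] tx[OF t] x by (meson le_less_trans)
        also have "\<dots> \<le> \<bar>C b\<bar> * norm (t *\<^sub>R x) ^ k" by (intro mult_right_mono) auto
        also have "\<dots> \<le> \<bar>C b\<bar> * norm x ^ k"
          by (intro mult_left_mono power_mono tx[OF t]) auto
        finally show "norm ((x \<bullet> b) *\<^sub>R (frechet_derivative f (at (u + t *\<^sub>R x)) b - P b (t *\<^sub>R x)))
            \<le> norm x * (\<bar>C b\<bar> * norm x ^ k)"
          unfolding norm_scaleR real_norm_def using Basis_le_norm[OF b, of x]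
          by (intro mult_mono) auto
      qed
      then show ?thesis
        unfolding K_def by (simp add: sum_distrib_left sum_distrib_right mult_ac)
    qed
    have "norm (g 1 - g 0) \<le> norm ((1::real) - 0) * (K * norm x ^ Suc k)"
    proof (rule differentiable_bound[of "{0..1}" g "\<lambda>t s. s *\<^sub>R g' t", THEN order_trans])
      fix t :: real assume t: "t \<in> {0..1}"
      show "(g has_derivative (\<lambda>s. s *\<^sub>R g' t)) (at t within {0..1})"
        using der[OF t] by (auto simp: has_vector_derivative_def intro: has_derivative_at_withinI)
      show "onorm (\<lambda>s. s *\<^sub>R g' t) \<le> K * norm x ^ Suc k"
        using bound[OF t] norm_ge_zero[of "g' t"]
        by (intro onorm_bound) (auto simp: mult.commute intro!: mult_left_mono simp del: norm_ge_zero)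
    qed auto
    then show ?thesis
      by (simp add: g_def R0)
  qed
  then show ?thesis
    using \<delta> unfolding eventually_nhds_metric dist_norm by auto
qed

lemma C_k_bounded:
  assumes "C_k k S f" "open S" "u \<in> S"
  shows "\<exists>C. \<forall>\<^sub>F x in nhds 0. norm (f (u + x)) \<le> C"
proof -
  have "isCont f u"
    using C_k_imp_continuous_on[OF assms(1)] assms(2,3) continuous_on_eq_continuous_at by blast
  then have "((\<lambda>x. f (u + x)) \<longlongrightarrow> f (u + 0)) (nhds 0)"
    using tendsto_at_iff_tendsto_nhds[of "\<lambda>x. f (u + x)" 0] by (simp add: isCont_iff)
  from tendsto_norm[OF this] have "((\<lambda>x. norm (f (u + x))) \<longlongrightarrow> norm (f u)) (nhds 0)"
    by simp
  then have "\<forall>\<^sub>F x in nhds 0. norm (f (u + x)) < norm (f u) + 1"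
    by (rule order_tendstoD(2)) simp
  then show ?thesis
    by (intro exI[of _ "norm (f u) + 1"]) (auto elim: eventually_mono)
qed

text \<open>Local bounds on the directional derivatives along the basis are the order-zero input
  that \<open>expansion_step\<close> integrates once. The next two lemmas repeat the pattern with
  longer expansions of these derivatives.\<close>

lemma C_k_expand_1:
  fixes f :: "'a::euclidean_space \<Rightarrow> 'b::real_normed_vector"
  assumes "C_k (Suc k) S f" "open S" "u \<in> S"
  shows "\<exists>C. \<forall>\<^sub>F x in nhds 0. norm (f (u + x) - f u) \<le> C * norm x"
proof -
  have "\<forall>b\<in>Basis. \<exists>C. \<forall>\<^sub>F x in nhds 0. norm (frechet_derivative f (at (u + x)) b) \<le> C"
    using assms by (intro ballI C_k_bounded[of k S]) auto
  from bchoice[OF this] obtain C where C: "\<And>b. b \<in> Basis \<Longrightarrow>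
      \<forall>\<^sub>F x in nhds 0. norm (frechet_derivative f (at (u + x)) b) \<le> C b"
    by blast
  show ?thesis
    using expansion_step[where f = f and S = S and u = u and P = "\<lambda>_ _. 0" and R = "\<lambda>_. f u"
        and C = C and k = 0] assms C by auto
qed

lemma C_k_expand_2:
  fixes f :: "'a::euclidean_space \<Rightarrow> 'b::real_normed_vector"
  assumes "C_k (Suc (Suc k)) S f" "open S" "u \<in> S"
  shows "\<exists>C. \<forall>\<^sub>F x in nhds 0.
    norm (f (u + x) - (f u + (\<Sum>b\<in>Basis. (x \<bullet> b) *\<^sub>R frechet_derivative f (at u) b))) \<le> C * norm x ^ 2"
proof -
  let ?D = "\<lambda>b. frechet_derivative f (at u) b"
  have "\<forall>b\<in>Basis. \<exists>C. \<forall>\<^sub>F x in nhds 0. norm (frechet_derivative f (at (u + x)) b - ?D b) \<le> C * norm x"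
    using assms by (intro ballI C_k_expand_1[of k S]) auto
  from bchoice[OF this] obtain C where C: "\<And>b. b \<in> Basis \<Longrightarrow>
      \<forall>\<^sub>F x in nhds 0. norm (frechet_derivative f (at (u + x)) b - ?D b) \<le> C b * norm x"
    by blast
  have "\<exists>K. \<forall>\<^sub>F x in nhds 0.
    norm (f (u + x) - (f u + (\<Sum>b\<in>Basis. (x \<bullet> b) *\<^sub>R ?D b))) \<le> K * norm x ^ Suc 1"
  proof (rule expansion_step[where S = S and P = "\<lambda>b _. ?D b" and C = C])
    show "((\<lambda>t. f u + (\<Sum>b\<in>Basis. (t *\<^sub>R x \<bullet> b) *\<^sub>R ?D b)) has_vector_derivative
        (\<Sum>b\<in>Basis. (x \<bullet> b) *\<^sub>R ?D b)) (at t)" for x t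
      by (auto intro!: derivative_eq_intros simp: has_vector_derivative_def scaleR_sum_right
          inner_commute)
  qed (use assms C in auto)
  then show ?thesis by (simp add: numeral_2_eq_2)
qed

text \<open>The quadratic term is written with iterated directional derivatives, so the symmetry of
  the second derivative is not needed.\<close>

lemma C_k_expand_3:
  fixes f :: "'a::euclidean_space \<Rightarrow> 'b::real_normed_vector"
  assumes "C_k (Suc (Suc (Suc k))) S f" "open S" "u \<in> S"
  shows "\<exists>C. \<forall>\<^sub>F x in nhds 0.
    norm (f (u + x) - (f u + (\<Sum>b\<in>Basis. (x \<bullet> b) *\<^sub>R frechet_derivative f (at u) b) +
      (1 / 2) *\<^sub>R (\<Sum>b\<in>Basis. (x \<bullet> b) *\<^sub>R (\<Sum>b'\<in>Basis. (x \<bullet> b') *\<^sub>R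
        frechet_derivative (\<lambda>y. frechet_derivative f (at y) b) (at u) b')))) \<le> C * norm x ^ 3"
proof -
  let ?D = "\<lambda>b. frechet_derivative f (at u) b"
  let ?E = "\<lambda>b b'. frechet_derivative (\<lambda>y. frechet_derivative f (at y) b) (at u) b'"
  have "\<forall>b\<in>Basis. \<exists>C. \<forall>\<^sub>F x in nhds 0. norm (frechet_derivative f (at (u + x)) b -
      (?D b + (\<Sum>b'\<in>Basis. (x \<bullet> b') *\<^sub>R ?E b b'))) \<le> C * norm x ^ 2"
    using assms by (intro ballI C_k_expand_2[of k S]) auto
  from bchoice[OF this] obtain C where C: "\<And>b. b \<in> Basis \<Longrightarrow>
      \<forall>\<^sub>F x in nhds 0. norm (frechet_derivative f (at (u + x)) b -
      (?D b + (\<Sum>b'\<in>Basis. (x \<bullet> b') *\<^sub>R ?E b b'))) \<le> C b * norm x ^ 2"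
    by blast
  have quad: "((\<lambda>t. c + t *\<^sub>R a + (t\<^sup>2 / 2) *\<^sub>R q) has_vector_derivative (a + t *\<^sub>R q)) (at t)"
    for c a q :: 'b and t
    by (auto intro!: derivative_eq_intros simp: has_vector_derivative_def algebra_simps)
  have "\<exists>K. \<forall>\<^sub>F x in nhds 0.
    norm (f (u + x) - (f u + (\<Sum>b\<in>Basis. (x \<bullet> b) *\<^sub>R ?D b) +
      (1 / 2) *\<^sub>R (\<Sum>b\<in>Basis. (x \<bullet> b) *\<^sub>R (\<Sum>b'\<in>Basis. (x \<bullet> b') *\<^sub>R ?E b b')))) \<le> K * norm x ^ Suc 2"
  proof (rule expansion_step[where S = S and C = C and
        P = "\<lambda>b x. ?D b + (\<Sum>b'\<in>Basis. (x \<bullet> b') *\<^sub>R ?E b b')"])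
    fix x :: 'a and t :: real
    let ?a = "\<Sum>b\<in>Basis. (x \<bullet> b) *\<^sub>R ?D b"
    let ?q = "\<Sum>b\<in>Basis. (x \<bullet> b) *\<^sub>R (\<Sum>b'\<in>Basis. (x \<bullet> b') *\<^sub>R ?E b b')"
    have "((\<lambda>t. f u + t *\<^sub>R ?a + (t\<^sup>2 / 2) *\<^sub>R ?q) has_vector_derivative (?a + t *\<^sub>R ?q)) (at t)"
      by (rule quad)
    moreover have "(\<lambda>t. f u + t *\<^sub>R ?a + (t\<^sup>2 / 2) *\<^sub>R ?q) =
       (\<lambda>t. f u + (\<Sum>b\<in>Basis. (t *\<^sub>R x \<bullet> b) *\<^sub>R ?D b) +
        (1 / 2) *\<^sub>R (\<Sum>b\<in>Basis. (t *\<^sub>R x \<bullet> b) *\<^sub>R (\<Sum>b'\<in>Basis. (t *\<^sub>R x \<bullet> b') *\<^sub>R ?E b b')))"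
      by (auto simp: scaleR_sum_right power2_eq_square mult_ac)
    moreover have "?a + t *\<^sub>R ?q =
        (\<Sum>b\<in>Basis. (x \<bullet> b) *\<^sub>R (?D b + (\<Sum>b'\<in>Basis. (t *\<^sub>R x \<bullet> b') *\<^sub>R ?E b b')))"
      by (simp add: scaleR_sum_right scaleR_add_right sum.distrib mult_ac)
    ultimately show "((\<lambda>t. f u + (\<Sum>b\<in>Basis. (t *\<^sub>R x \<bullet> b) *\<^sub>R ?D b) +
        (1 / 2) *\<^sub>R (\<Sum>b\<in>Basis. (t *\<^sub>R x \<bullet> b) *\<^sub>R (\<Sum>b'\<in>Basis. (t *\<^sub>R x \<bullet> b') *\<^sub>R ?E b b')))
      has_vector_derivative
        (\<Sum>b\<in>Basis. (x \<bullet> b) *\<^sub>R (?D b + (\<Sum>b'\<in>Basis. (t *\<^sub>R x \<bullet> b') *\<^sub>R ?E b b')))) (at t)"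
      by (simp only:)
  next
    show "f differentiable at x" if "x \<in> S" for x
      using assms(1) that by simp
  next
    show "\<forall>\<^sub>F x in nhds 0. norm (frechet_derivative f (at (u + x)) b -
      (?D b + (\<Sum>b'\<in>Basis. (x \<bullet> b') *\<^sub>R ?E b b'))) \<le> C b * norm x ^ 2" if "b \<in> Basis" for b
      using that by (rule C)
  qed (use assms(2,3) in simp_all)
  then show ?thesis by (simp add: numeral_3_eq_3)
qed

text \<open>\<open>B\<close> is half of the second derivative.\<close>

definition taylor2 ::
  "('a::real_normed_vector \<Rightarrow> 'b::real_normed_vector) \<Rightarrow> 'a \<Rightarrow> ('a \<Rightarrow> 'b) \<Rightarrow> ('a \<Rightarrow> 'a \<Rightarrow> 'b) \<Rightarrow> bool" where
  "taylor2 f u D B \<longleftrightarrow> bounded_linear D \<and> bounded_bilinear B \<and>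
     (\<exists>C. \<forall>\<^sub>F x in nhds 0. norm (f (u + x) - (f u + D x + B x x)) \<le> C * norm x ^ 3)"

lemma C_k_imp_taylor2:
  fixes f :: "'a::euclidean_space \<Rightarrow> 'b::euclidean_space"
  assumes "C_k (Suc (Suc (Suc k))) S f" "open S" "u \<in> S"
  shows "\<exists>B. taylor2 f u (frechet_derivative f (at u)) B"
proof -
  let ?D = "frechet_derivative f (at u)"
  let ?E = "\<lambda>b b'. frechet_derivative (\<lambda>y. frechet_derivative f (at y) b) (at u) b'"
  \<comment> \<open>The coordinates of both arguments enter linearly, so bilinearity is immediate;
    boundedness then comes from finite dimension.\<close>
  define B where "B x y = (1 / 2) *\<^sub>R (\<Sum>b\<in>Basis. (x \<bullet> b) *\<^sub>R (\<Sum>b'\<in>Basis. (y \<bullet> b') *\<^sub>R ?E b b'))" for x y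
  have "(f has_derivative ?D) (at u)"
    using assms by (simp add: frechet_derivative_works)
  then have D: "bounded_linear ?D"
    by (rule has_derivative_bounded_linear)
  have lin: "linear ?D"
    using D by (rule bounded_linear.linear)
  have D_eq: "?D x = (\<Sum>b\<in>Basis. (x \<bullet> b) *\<^sub>R ?D b)" for x
    using lin by (rule linear_eq_sum_Basis)
  have "bilinear B"
    unfolding bilinear_def B_def
  proof (intro conjI allI linearI; (simp add: inner_add_left scaleR_add_left scaleR_add_right sum.distrib; fail)?)
  qed (simp_all add: scaleR_sum_right mult_ac)
  then have "bounded_bilinear B"
    by (simp add: bilinear_conv_bounded_bilinear)
  with D show ?thesis
    using C_k_expand_3[OF assms] unfolding taylor2_def D_eq[symmetric] B_def by blast
qed

section \<open>Congruence up to \<open>O(h^k)\<close> and integration in the step size\<close>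

definition approx :: "nat \<Rightarrow> (real \<Rightarrow> 'a::real_normed_vector) \<Rightarrow> (real \<Rightarrow> 'a) \<Rightarrow> bool" where
  "approx k f g \<longleftrightarrow> hO k (\<lambda>h. f h - g h)"

lemma approx_refl [simp, intro]: "approx k f f"
  by (simp add: approx_def)

lemma approx_sym: "approx k f g \<Longrightarrow> approx k g f"
  unfolding approx_def by (rule hO_diff_swap)

lemma approx_trans [trans]: "approx k f g \<Longrightarrow> approx k g e \<Longrightarrow> approx k f e"
  unfolding approx_def by (rule hO_trans)

lemma approx_mono: "approx k f g \<Longrightarrow> l \<le> k \<Longrightarrow> approx l f g"
  unfolding approx_def by (rule hO_mono)

lemma approx_eventually_eq: "\<forall>\<^sub>F h in at_right 0. f h = g h \<Longrightarrow> approx k f g"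
  unfolding approx_def by (rule hO_eqI[OF hO_zero]) (auto elim: eventually_mono)

lemma approx_add: "approx k f f' \<Longrightarrow> approx k g g' \<Longrightarrow> approx k (\<lambda>h. f h + g h) (\<lambda>h. f' h + g' h)"
  unfolding approx_def using hO_add[of k "\<lambda>h. f h - f' h" "\<lambda>h. g h - g' h"]
  by (simp add: algebra_simps)

lemma approx_sum: "(\<And>i. i \<in> I \<Longrightarrow> approx k (f i) (g i)) \<Longrightarrow> approx k (\<lambda>h. \<Sum>i\<in>I. f i h) (\<lambda>h. \<Sum>i\<in>I. g i h)"
  unfolding approx_def using hO_sum[of I k "\<lambda>i h. f i h - g i h"] by (simp add: sum_subtractf)

lemma approx_linear: "bounded_linear L \<Longrightarrow> approx k f g \<Longrightarrow> approx k (\<lambda>h. L (f h)) (\<lambda>h. L (g h))"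
  unfolding approx_def
  using hO_linear[of L k "\<lambda>h. f h - g h"] by (simp add: bounded_linear.linear linear_diff)

lemma approx_cscale: "approx k f g \<Longrightarrow> approx k (\<lambda>h. c *\<^sub>R f h) (\<lambda>h. c *\<^sub>R g h)"
  by (rule approx_linear[OF bounded_linear_scaleR_right])

lemma approx_shift: "approx k f g \<Longrightarrow> approx (Suc k) (\<lambda>h. h *\<^sub>R f h) (\<lambda>h. h *\<^sub>R g h)"
  unfolding approx_def using hO_shift[of k "\<lambda>h. f h - g h"] by (simp add: scaleR_diff_right)

lemma approx_step: "approx k f g \<Longrightarrow> approx (Suc k) (\<lambda>h. u + h *\<^sub>R f h) (\<lambda>h. u + h *\<^sub>R g h)"
  by (intro approx_add approx_shift approx_refl)

lemma approx_bounded: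
  assumes "approx k f g" "hO 0 g"
  shows "hO 0 f"
proof -
  have "hO 0 (\<lambda>h. f h - g h)" using hO_mono[OF assms(1)[unfolded approx_def], of 0] by simp
  from hO_add[OF this assms(2)] show ?thesis by simp
qed

lemma approx_const_bounded: "approx k f (\<lambda>h. c) \<Longrightarrow> hO 0 f"
  by (rule approx_bounded) auto

text \<open>\<open>B f g - B f' g' = B (f - f') g + B f' (g - g')\<close> leaves \<open>g\<close>
  and \<open>f'\<close> undifferenced, which is why boundedness is asked of these two.\<close>

lemma approx_bilinear:
  assumes B: "bounded_bilinear B" and "approx k f f'" "approx k g g'" "hO 0 f'" "hO 0 g"
  shows "approx k (\<lambda>h. B (f h) (g h)) (\<lambda>h. B (f' h) (g' h))"
proof -
  have 1: "hO (k + 0) (\<lambda>h. B (f h - f' h) (g h))"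
    using assms(2,5) unfolding approx_def by (rule hO_prod[OF B])
  have 2: "hO (0 + k) (\<lambda>h. B (f' h) (g h - g' h))"
    using assms(4,3) unfolding approx_def by (rule hO_prod[OF B])
  from hO_add[OF 1[simplified] 2[simplified]] show ?thesis
    unfolding approx_def
    by (simp add: bounded_bilinear.diff_left[OF B] bounded_bilinear.diff_right[OF B])
qed

lemma approx_scaleR:
  assumes "approx k f f'" "approx k g g'" "hO 0 f'" "hO 0 g"
  shows "approx k (\<lambda>h. f h *\<^sub>R g h) (\<lambda>h. f' h *\<^sub>R g' h)"
  using assms by (rule approx_bilinear[OF bounded_bilinear_scaleR])

text \<open>Mean value inequality on \<open>{0..h}\<close>, with the slope frozen at its largest
  bound \<open>C * h ^ k\<close>. It raises the accuracy of an expansion of an ODE solution by one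
  order.\<close>

lemma hO_integrate:
  assumes "0 < T"
    and der: "\<And>t. t \<in> {0..T} \<Longrightarrow> (\<phi> has_vector_derivative \<phi>' t) (at t within {0..T})"
    and "\<phi> 0 = 0" and "hO k \<phi>'"
  shows "hO (Suc k) \<phi>"
proof -
  obtain C where C: "C > 0" "\<forall>\<^sub>F h in at_right 0. norm (\<phi>' h) \<le> C * h ^ k"
    using assms(4) by (rule hOE)
  then obtain r where r: "r > 0" "\<And>h. 0 < h \<Longrightarrow> h < r \<Longrightarrow> norm (\<phi>' h) \<le> C * h ^ k"
    unfolding eventually_at_right_field by auto
  have "norm (\<phi> h) \<le> C * h ^ Suc k" if h: "0 < h" "h < min r T" for h
  proof -
    have "norm (\<phi> h - \<phi> 0) \<le> C * h ^ k * h - C * h ^ k * 0"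
    proof (rule differentiable_bound_general[where \<phi> = "\<lambda>t. C * h ^ k * t" and \<phi>' = "\<lambda>t. C * h ^ k"])
      show "continuous_on {0..h} \<phi>"
        by (rule continuous_on_subset[OF continuous_on_vector_derivative[OF der]]) (use h in auto)
      show "(\<phi> has_vector_derivative \<phi>' t) (at t)" if "0 < t" "t < h" for t
      proof -
        have "(\<phi> has_vector_derivative \<phi>' t) (at t within {0<..<T})"
          by (rule has_vector_derivative_within_subset[OF der]) (use that h in auto)
        then show ?thesis
          using that h at_within_open[of t "{0<..<T}"] by simp
      qed
      show "norm (\<phi>' t) \<le> C * h ^ k" if "0 < t" "t < h" for t
      proof -
        have "norm (\<phi>' t) \<le> C * t ^ k" using r(2)[of t] that h by simp
        also have "\<dots> \<le> C * h ^ k" using that C(1) by (intro mult_left_mono power_mono) auto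
        finally show ?thesis .
      qed
      show "((\<lambda>t. C * h ^ k * t) has_vector_derivative C * h ^ k) (at t)" for t
        by (auto intro!: derivative_eq_intros simp: has_vector_derivative_def mult_ac)
    qed (use h in \<open>auto intro!: continuous_intros\<close>)
    then show ?thesis by (simp add: assms(3) mult_ac)
  qed
  then show ?thesis
    using r(1) assms(1)
    by (intro hOI[of _ C]) (auto simp: eventually_at_right_field intro!: exI[of _ "min r T"])
qed

section \<open>Taylor expansions of sums, and substitution of displacements of size
  \<open>O(h)\<close>\<close>

lemma bounded_bilinear_zero: "bounded_bilinear (\<lambda>x y. 0)"
  by standard (auto intro: exI[of _ 0])

lemma bounded_bilinear_add:
  assumes "bounded_bilinear B" "bounded_bilinear B'"
  shows "bounded_bilinear (\<lambda>x y. B x y + B' x y)"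
proof
  obtain K where K: "\<And>x y. norm (B x y) \<le> norm x * norm y * K"
    using bounded_bilinear.bounded[OF assms(1)] by blast
  obtain K' where K': "\<And>x y. norm (B' x y) \<le> norm x * norm y * K'"
    using bounded_bilinear.bounded[OF assms(2)] by blast
  have "norm (B x y + B' x y) \<le> norm x * norm y * (K + K')" for x y
    using norm_triangle_mono[OF K K'] by (simp add: distrib_left)
  then show "\<exists>K. \<forall>x y. norm (B x y + B' x y) \<le> norm x * norm y * K"
    by blast
qed (simp_all add: assms[THEN bounded_bilinear.add_left] assms[THEN bounded_bilinear.add_right]
    assms[THEN bounded_bilinear.scaleR_left] assms[THEN bounded_bilinear.scaleR_right] algebra_simps)

lemma taylor2_sum:
  assumes "finite I" "\<And>i. i \<in> I \<Longrightarrow> taylor2 (G i) u (D i) (B i)"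
  shows "taylor2 (\<lambda>x. \<Sum>i\<in>I. G i x) u (\<lambda>x. \<Sum>i\<in>I. D i x) (\<lambda>x y. \<Sum>i\<in>I. B i x y)"
  using assms
proof (induction I rule: finite_induct)
  case empty
  then show ?case by (auto simp: taylor2_def bounded_bilinear_zero intro: exI[of _ 0])
next
  case (insert i I)
  let ?G = "\<lambda>x. \<Sum>i\<in>I. G i x" and ?D = "\<lambda>x. \<Sum>i\<in>I. D i x" and ?B = "\<lambda>x y. \<Sum>i\<in>I. B i x y"
  have 1: "taylor2 ?G u ?D ?B" and 2: "taylor2 (G i) u (D i) (B i)"
    using insert by auto
  obtain C1 where C1: "\<forall>\<^sub>F x in nhds 0. norm (?G (u + x) - (?G u + ?D x + ?B x x)) \<le> C1 * norm x ^ 3"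
    using 1 unfolding taylor2_def by blast
  obtain C2 where C2: "\<forall>\<^sub>F x in nhds 0. norm (G i (u + x) - (G i u + D i x + B i x x)) \<le> C2 * norm x ^ 3"
    using 2 unfolding taylor2_def by blast
  have "\<forall>\<^sub>F x in nhds 0. norm ((G i (u + x) + ?G (u + x)) - ((G i u + ?G u) + (D i x + ?D x) + (B i x x + ?B x x)))
      \<le> (C2 + C1) * norm x ^ 3"
    using C1 C2
  proof eventually_elim
    case (elim x)
    have "(G i (u + x) + ?G (u + x)) - ((G i u + ?G u) + (D i x + ?D x) + (B i x x + ?B x x)) =
      (G i (u + x) - (G i u + D i x + B i x x)) + (?G (u + x) - (?G u + ?D x + ?B x x))"
      by (simp add: algebra_simps)
    with elim show ?case
      using norm_triangle_ineq[of "G i (u + x) - (G i u + D i x + B i x x)" "?G (u + x) - (?G u + ?D x + ?B x x)"]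
      by (simp add: algebra_simps)
  qed
  then show ?case
    using 1 2 insert(1,2) unfolding taylor2_def
    by (auto intro!: bounded_linear_add bounded_bilinear_add)
qed

text \<open>The displacement is \<open>O(h)\<close>, so the cubic remainder becomes
  \<open>O(h^3)\<close>; the following two versions discard first the quadratic and then the linear
  term as well.\<close>

lemma taylor2_approx_3:
  assumes "taylor2 f u D B" "approx 1 V (\<lambda>h. u)"
  shows "approx 3 (\<lambda>h. f (V h)) (\<lambda>h. f u + D (V h - u) + B (V h - u) (V h - u))"
proof -
  let ?X = "\<lambda>h. V h - u"
  have X: "hO 1 ?X" using assms(2) by (simp add: approx_def)
  have lim: "filterlim ?X (nhds 0) (at_right 0)"
    using hO_imp_tendsto_0[of 0 ?X] X by simp
  obtain C where "\<forall>\<^sub>F x in nhds 0. norm (f (u + x) - (f u + D x + B x x)) \<le> C * norm x ^ 3"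
    using assms(1) unfolding taylor2_def by blast
  from eventually_compose_filterlim[OF this lim]
  have ev: "\<forall>\<^sub>F h in at_right 0. norm (f (V h) - (f u + D (?X h) + B (?X h) (?X h))) \<le> C * norm (?X h) ^ 3"
    by simp
  have "hO (1 + (1 + 1)) (\<lambda>h. norm (?X h) * (norm (?X h) * norm (?X h)))"
    using X by (intro hO_mult) (auto simp: hO_def)
  then have "hO 3 (\<lambda>h. C * norm (?X h) ^ 3)"
    by (intro hO_cmult) (simp add: power3_eq_cube numeral_3_eq_3 mult_ac)
  then obtain K where "\<forall>\<^sub>F h in at_right 0. norm (C * norm (?X h) ^ 3) \<le> K * h ^ 3"
    by (rule hOE)
  with ev show ?thesis
    unfolding approx_def by (intro hOI[of _ K], eventually_elim) auto
qed

lemma taylor2_approx_2: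
  assumes "taylor2 f u D B" "approx 1 V (\<lambda>h. u)"
  shows "approx 2 (\<lambda>h. f (V h)) (\<lambda>h. f u + D (V h - u))"
proof -
  have "approx 2 (\<lambda>h. f (V h)) (\<lambda>h. f u + D (V h - u) + B (V h - u) (V h - u))"
    using taylor2_approx_3[OF assms] by (rule approx_mono) simp
  moreover have "hO 2 (\<lambda>h. B (V h - u) (V h - u))"
    using assms hO_prod[of B 1 "\<lambda>h. V h - u" 1 "\<lambda>h. V h - u", unfolded one_add_one]
    unfolding taylor2_def approx_def by blast
  then have "approx 2 (\<lambda>h. f u + D (V h - u) + B (V h - u) (V h - u)) (\<lambda>h. f u + D (V h - u))"
    by (simp add: approx_def)
  ultimately show ?thesis by (rule approx_trans)
qed

lemma taylor2_approx_1:
  assumes "taylor2 f u D B" "approx 1 V (\<lambda>h. u)"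
  shows "approx 1 (\<lambda>h. f (V h)) (\<lambda>h. f u)"
proof -
  have "approx 1 (\<lambda>h. f (V h)) (\<lambda>h. f u + D (V h - u))"
    using taylor2_approx_2[OF assms] by (rule approx_mono) simp
  moreover have "hO 1 (\<lambda>h. D (V h - u))"
    using assms hO_linear[of D 1 "\<lambda>h. V h - u"]
    unfolding taylor2_def approx_def by blast
  then have "approx 1 (\<lambda>h. f u + D (V h - u)) (\<lambda>h. f u)"
    by (simp add: approx_def)
  ultimately show ?thesis by (rule approx_trans)
qed

text \<open>Repeated integration: an expansion of the solution gives one of the right-hand side
  along it of the same order, whose integral is accurate to one order more. As \<open>B\<close> is
  half the second derivative, the term \<open>F''(F, F) / 6\<close> reads
  \<open>B (F u) (F u) / 3\<close>.\<close>

lemma ode_solution_approx: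
  assumes sol: "ode_solution S F y t0 T" and F: "taylor2 F u D B" and u: "y t0 = u"
  shows "approx 4 (\<lambda>h. y (t0 + h))
    (\<lambda>h. u + h *\<^sub>R F u + (h\<^sup>2 / 2) *\<^sub>R D (F u) + h ^ 3 *\<^sub>R ((1 / 6) *\<^sub>R D (D (F u)) + (1 / 3) *\<^sub>R B (F u) (F u)))"
proof -
  have D: "bounded_linear D" and B: "bounded_bilinear B"
    using F by (auto simp: taylor2_def)
  have linD: "linear D" using D by (rule bounded_linear.linear)
  define x where "x h = y (t0 + h)" for h
  have T: "0 < T" using sol by (simp add: ode_solution_def)
  have der: "(x has_vector_derivative F (x t)) (at t within {0..T})" if "t \<in> {0..T}" for t
  proof -
    have "(y has_vector_derivative F (y (t0 + t))) (at (t0 + t) within (+) t0 ` {0..T})"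
      using sol that by (auto simp: ode_solution_def add.commute)
    moreover have "((+) t0 has_vector_derivative 1) (at t within {0..T})"
      by (auto intro!: derivative_eq_intros)
    ultimately show ?thesis
      unfolding x_def[abs_def] using vector_diff_chain_within by (fastforce simp: o_def)
  qed
  have x0: "x 0 = u" by (simp add: x_def u)
  \<comment> \<open>Integration needs an order for \<open>F (x t) - F u\<close> to begin with; it is
    read off from the difference quotient at \<open>0\<close>, with tolerance
    \<open>1\<close>.\<close>
  have x1: "approx 1 x (\<lambda>h. u)"
  proof -
    have "(x has_derivative (\<lambda>s. s *\<^sub>R F u)) (at 0 within {0..T})"
      using der[of 0] T x0 by (simp add: has_vector_derivative_def)
    then have "\<exists>r>0. \<forall>h\<in>{0..T}. 0 < norm (h - 0) \<and> norm (h - 0) < r \<longrightarrow>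
        norm (x h - x 0 - (h - 0) *\<^sub>R F u) / norm (h - 0) < 1"
      unfolding has_derivative_within' by (blast intro: zero_less_one)
    then obtain r where r: "r > 0" "\<And>h. h \<in> {0..T} \<Longrightarrow> 0 < \<bar>h\<bar> \<Longrightarrow> \<bar>h\<bar> < r \<Longrightarrow>
        norm (x h - u - h *\<^sub>R F u) / \<bar>h\<bar> < 1"
      by (auto simp: x0)
    have "norm (x h - u) \<le> (1 + norm (F u)) * h ^ 1" if "0 < h" "h < min r T" for h
    proof -
      have "norm (x h - u - h *\<^sub>R F u) \<le> h"
        using r(2)[of h] that by simp
      then show ?thesis
        using norm_triangle_ineq[of "x h - u - h *\<^sub>R F u" "h *\<^sub>R F u"] that by (simp add: algebra_simps)
    qed
    then show ?thesis
      unfolding approx_def using r(1) T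
      by (intro hOI[of _ "1 + norm (F u)"]) (auto simp: eventually_at_right_field intro!: exI[of _ "min r T"])
  qed
  have "hO (Suc 1) (\<lambda>h. x h - (u + h *\<^sub>R F u))"
  proof (rule hO_integrate[OF T])
    show "((\<lambda>h. x h - (u + h *\<^sub>R F u)) has_vector_derivative F (x t) - F u) (at t within {0..T})"
      if "t \<in> {0..T}" for t
      using der[OF that] by (auto intro!: derivative_eq_intros)
    show "hO 1 (\<lambda>t. F (x t) - F u)"
      using taylor2_approx_1[OF F x1] by (simp add: approx_def)
  qed (simp add: x0)
  then have x2: "approx 2 (\<lambda>h. x h - u) (\<lambda>h. h *\<^sub>R F u)"
    by (simp add: approx_def numeral_2_eq_2 algebra_simps)
  have F2: "approx 2 (\<lambda>h. F (x h)) (\<lambda>h. F u + h *\<^sub>R D (F u))"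
  proof -
    have "approx 2 (\<lambda>h. F (x h)) (\<lambda>h. F u + D (x h - u))"
      by (rule taylor2_approx_2[OF F x1])
    also have "approx 2 \<dots> (\<lambda>h. F u + D (h *\<^sub>R F u))"
      by (intro approx_add approx_refl approx_linear[OF D] x2)
    finally show ?thesis by (simp add: linear_cmul[OF linD])
  qed
  have "hO (Suc 2) (\<lambda>h. x h - (u + h *\<^sub>R F u + (h\<^sup>2 / 2) *\<^sub>R D (F u)))"
  proof (rule hO_integrate[OF T])
    show "((\<lambda>h. x h - (u + h *\<^sub>R F u + (h\<^sup>2 / 2) *\<^sub>R D (F u))) has_vector_derivative
        F (x t) - (F u + t *\<^sub>R D (F u))) (at t within {0..T})" if "t \<in> {0..T}" for t
      using der[OF that] by (auto intro!: derivative_eq_intros)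
  qed (use F2 x0 in \<open>auto simp: approx_def\<close>)
  then have x3: "approx 3 (\<lambda>h. x h - u) (\<lambda>h. h *\<^sub>R F u + (h\<^sup>2 / 2) *\<^sub>R D (F u))"
    by (simp add: approx_def numeral_3_eq_3 algebra_simps)
  have F3: "approx 3 (\<lambda>h. F (x h)) (\<lambda>h. F u + h *\<^sub>R D (F u) + h\<^sup>2 *\<^sub>R ((1 / 2) *\<^sub>R D (D (F u)) + B (F u) (F u)))"
  proof -
    have "approx 3 (\<lambda>h. F (x h)) (\<lambda>h. F u + D (x h - u) + B (x h - u) (x h - u))"
      by (rule taylor2_approx_3[OF F x1])
    also have "approx 3 \<dots> (\<lambda>h. F u + D (h *\<^sub>R F u + (h\<^sup>2 / 2) *\<^sub>R D (F u)) + B (h *\<^sub>R F u) (h *\<^sub>R F u))"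
    proof (intro approx_add approx_refl approx_linear[OF D] x3)
      \<comment> \<open>One factor is a difference of order 2 and the other is itself of order 1, so
        the product gains a third order that \<open>approx_bilinear\<close> would not see.\<close>
      have 1: "hO (2 + 1) (\<lambda>h. B (x h - u - h *\<^sub>R F u) (x h - u))"
        using x2 x1 by (intro hO_prod[OF B]) (auto simp: approx_def)
      have "hO 1 (\<lambda>h. h *\<^sub>R F u)"
        using hO_shift[OF hO_const] by simp
      then have 2: "hO (1 + 2) (\<lambda>h. B (h *\<^sub>R F u) (x h - u - h *\<^sub>R F u))"
        using x2 by (intro hO_prod[OF B]) (auto simp: approx_def)
      show "approx 3 (\<lambda>h. B (x h - u) (x h - u)) (\<lambda>h. B (h *\<^sub>R F u) (h *\<^sub>R F u))"
        unfolding approx_def using hO_add[OF 1 2[unfolded add.commute[of 1]]]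
        by (simp add: bounded_bilinear.diff_left[OF B] bounded_bilinear.diff_right[OF B])
    qed
    finally show ?thesis
      by (simp add: linear_add[OF linD] linear_cmul[OF linD] bounded_bilinear.scaleR_left[OF B]
          bounded_bilinear.scaleR_right[OF B] power2_eq_square algebra_simps)
  qed
  have "hO (Suc 3) (\<lambda>h. x h - (u + h *\<^sub>R F u + (h\<^sup>2 / 2) *\<^sub>R D (F u) +
      h ^ 3 *\<^sub>R ((1 / 6) *\<^sub>R D (D (F u)) + (1 / 3) *\<^sub>R B (F u) (F u))))"
  proof (rule hO_integrate[OF T])
    show "((\<lambda>h. x h - (u + h *\<^sub>R F u + (h\<^sup>2 / 2) *\<^sub>R D (F u) +
          h ^ 3 *\<^sub>R ((1 / 6) *\<^sub>R D (D (F u)) + (1 / 3) *\<^sub>R B (F u) (F u)))) has_vector_derivative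
        F (x t) - (F u + t *\<^sub>R D (F u) + t\<^sup>2 *\<^sub>R ((1 / 2) *\<^sub>R D (D (F u)) + B (F u) (F u))))
        (at t within {0..T})" if "t \<in> {0..T}" for t
      using der[OF that] by (auto intro!: derivative_eq_intros simp: algebra_simps)
  qed (use F3 x0 in \<open>auto simp: approx_def\<close>)
  then show ?thesis
    by (simp add: approx_def x_def)
qed

section \<open>Additive steps with weights near 1\<close>

lemma stage_sets:
  "{1..3::nat} = {1, 2, 3}" "{2..3::nat} = {2, 3}"
  "{1..<1::nat} = {}" "{1..<2::nat} = {1}" "{1..<3::nat} = {1, 2}"
  by auto

lemma explicit_rk_3D:
  assumes "explicit_rk 3 A c"
  shows "c 1 = 0" "c 2 = A 2 1" "c 3 = A 3 1 + A 3 2"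
  using assms unfolding explicit_rk_def stage_sets by auto

lemma explicit_rk_3_sum:
  assumes "explicit_rk 3 A c" "i \<in> {1..3}"
  shows "c i = (\<Sum>j=1..<i. A i j)"
  using assms(2) explicit_rk_3D[OF assms(1)] unfolding stage_sets
  by (auto simp: stage_sets[unfolded One_nat_def])

text \<open>\<open>W i \<nu>\<close> and \<open>V \<nu>\<close> are the Patankar weights \<open>Y i $ \<nu> / \<rho> i \<nu>\<close> and \<open>z $ \<nu> / \<sigma> \<nu>\<close>,
  as functions of the step size.\<close>

locale weighted_step =
  fixes A :: "nat \<Rightarrow> nat \<Rightarrow> real" and b c :: "nat \<Rightarrow> real"
    and G :: "'n::finite \<Rightarrow> real^'n \<Rightarrow> real^'n" and D B u
    and W :: "nat \<Rightarrow> 'n \<Rightarrow> real \<Rightarrow> real" and V :: "'n \<Rightarrow> real \<Rightarrow> real"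
    and U :: "real \<Rightarrow> nat \<Rightarrow> real^'n" and z :: "real \<Rightarrow> real^'n"
  assumes rk: "explicit_rk 3 A c"
    and taylor: "\<And>\<nu>. taylor2 (G \<nu>) u (D \<nu>) (B \<nu>)"
    and step: "\<forall>\<^sub>F h in at_right 0. additive_step 3 (\<lambda>i j \<nu>. A i j * W i \<nu> h) (\<lambda>j \<nu>. b j * V \<nu> h) G u h (U h) (z h)"
    and W_bounded: "\<And>i \<nu>. i \<in> {2..3} \<Longrightarrow> hO 0 (W i \<nu>)"
begin

definition F where "F x = (\<Sum>\<nu>\<in>UNIV. G \<nu> x)"
definition DF where "DF x = (\<Sum>\<nu>\<in>UNIV. D \<nu> x)"
definition BF where "BF x y = (\<Sum>\<nu>\<in>UNIV. B \<nu> x y)"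

lemma taylor_F: "taylor2 F u DF BF"
  unfolding F_def[abs_def] DF_def[abs_def] BF_def[abs_def] by (rule taylor2_sum) (auto intro: taylor)

lemma D_linear: "bounded_linear (D \<nu>)"
  using taylor[of \<nu>] by (simp add: taylor2_def)

lemma DF_linear: "bounded_linear DF"
  using taylor_F by (simp add: taylor2_def)

lemma BF_bilinear: "bounded_bilinear BF"
  using taylor_F by (simp add: taylor2_def)

lemma stage_eq:
  assumes "i \<in> {1..3}"
  shows "\<forall>\<^sub>F h in at_right 0. U h i =
    u + h *\<^sub>R (\<Sum>j=1..<i. \<Sum>\<nu>\<in>UNIV. A i j *\<^sub>R (W i \<nu> h *\<^sub>R G \<nu> (U h j)))"
  using step by eventually_elim (use assms in \<open>simp add: additive_step_def\<close>)

lemma update_eq: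
  "\<forall>\<^sub>F h in at_right 0. z h = u + h *\<^sub>R (\<Sum>j=1..3. \<Sum>\<nu>\<in>UNIV. b j *\<^sub>R (V \<nu> h *\<^sub>R G \<nu> (U h j)))"
  using step by eventually_elim (simp add: additive_step_def)

text \<open>Induction over the stages: once the earlier stages are near \<open>u\<close>, the parts
  evaluated there are bounded, and the factor \<open>h\<close> makes the increment
  \<open>O(h)\<close>.\<close>

lemma stage_1: "i \<in> {1..3} \<Longrightarrow> approx 1 (\<lambda>h. U h i) (\<lambda>h. u)"
proof (induction i rule: less_induct)
  case (less i)
  have G: "hO 0 (\<lambda>h. G \<nu> (U h j))" if "j \<in> {1..<i}" for j \<nu>
    using that less by (intro approx_const_bounded[OF taylor2_approx_1[OF taylor]]) auto
  have "hO 0 (\<lambda>h. \<Sum>j=1..<i. \<Sum>\<nu>\<in>UNIV. A i j *\<^sub>R (W i \<nu> h *\<^sub>R G \<nu> (U h j)))"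
  proof (intro hO_sum hO_cscale)
    fix j \<nu> assume j: "j \<in> {1..<i}"
    \<comment> \<open>An index below \<open>i\<close> exists, so \<open>i\<close> is not the first
      stage, about whose weights nothing is assumed.\<close>
    then have "i \<in> {2..3}" using less.prems by auto
    from hO_scaleR[OF W_bounded[OF this] G[OF j]] show "hO 0 (\<lambda>h. W i \<nu> h *\<^sub>R G \<nu> (U h j))"
      by simp
  qed
  from hO_shift[OF this] have "approx 1 (\<lambda>h. u + h *\<^sub>R (\<Sum>j=1..<i. \<Sum>\<nu>\<in>UNIV. A i j *\<^sub>R (W i \<nu> h *\<^sub>R G \<nu> (U h j)))) (\<lambda>h. u)"
    by (simp add: approx_def)
  with approx_eventually_eq[OF stage_eq[OF less.prems]] show ?case
    by (rule approx_trans)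
qed

lemma part_1: "i \<in> {1..3} \<Longrightarrow> approx 1 (\<lambda>h. G \<nu> (U h i)) (\<lambda>h. G \<nu> u)"
  by (rule taylor2_approx_1[OF taylor stage_1])

lemma part_bounded: "i \<in> {1..3} \<Longrightarrow> hO 0 (\<lambda>h. G \<nu> (U h i))"
  by (rule approx_const_bounded[OF part_1])

text \<open>The factor \<open>h\<close> in front of the increment gains one order over what is known
  of \<open>V\<close> and the parts. The expansions \<open>X\<close> stay open because constant,
  linear and unexpanded ones are inserted below.\<close>

lemma update_approx:
  assumes V: "\<And>\<nu>. approx k (V \<nu>) (\<lambda>h. 1)"
    and X: "\<And>j \<nu>. j \<in> {1..3} \<Longrightarrow> approx k (\<lambda>h. G \<nu> (U h j)) (X j \<nu>)"
  shows "approx (Suc k) z (\<lambda>h. u + h *\<^sub>R (\<Sum>j=1..3. b j *\<^sub>R (\<Sum>\<nu>\<in>UNIV. X j \<nu> h)))"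
proof -
  have "approx (Suc k) z (\<lambda>h. u + h *\<^sub>R (\<Sum>j=1..3. \<Sum>\<nu>\<in>UNIV. b j *\<^sub>R (V \<nu> h *\<^sub>R G \<nu> (U h j))))"
    by (rule approx_eventually_eq[OF update_eq])
  also have "approx (Suc k) \<dots> (\<lambda>h. u + h *\<^sub>R (\<Sum>j=1..3. \<Sum>\<nu>\<in>UNIV. b j *\<^sub>R (1 *\<^sub>R X j \<nu> h)))"
  proof (intro approx_step approx_sum approx_cscale)
    fix j :: nat and \<nu> assume j: "j \<in> {1..3}"
    show "approx k (\<lambda>h. V \<nu> h *\<^sub>R G \<nu> (U h j)) (\<lambda>h. 1 *\<^sub>R X j \<nu> h)"
      using V X[OF j] hO_const part_bounded[OF j] by (rule approx_scaleR)
  qed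
  finally show ?thesis by (simp add: scaleR_sum_right)
qed

lemma update_2:
  assumes "\<And>\<nu>. approx 1 (V \<nu>) (\<lambda>h. 1)" "(\<Sum>j=1..3. b j) = 1"
  shows "approx 2 z (\<lambda>h. u + h *\<^sub>R F u)"
  using update_approx[OF assms(1) part_1] assms(2)
  by (simp add: F_def numeral_2_eq_2 flip: scaleR_sum_left)

context
  assumes W_1: "\<And>i \<nu>. i \<in> {2..3} \<Longrightarrow> approx 1 (W i \<nu>) (\<lambda>h. 1)"
begin

lemma stage_2:
  assumes i: "i \<in> {1..3}"
  shows "approx 2 (\<lambda>h. U h i) (\<lambda>h. u + h *\<^sub>R (c i *\<^sub>R F u))"
proof -
  have "approx (Suc 1) (\<lambda>h. U h i) (\<lambda>h. u + h *\<^sub>R (\<Sum>j=1..<i. \<Sum>\<nu>\<in>UNIV. A i j *\<^sub>R (W i \<nu> h *\<^sub>R G \<nu> (U h j))))"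
    by (rule approx_eventually_eq[OF stage_eq[OF i]])
  also have "approx (Suc 1) \<dots> (\<lambda>h. u + h *\<^sub>R (\<Sum>j=1..<i. \<Sum>\<nu>\<in>UNIV. A i j *\<^sub>R (1 *\<^sub>R G \<nu> u)))"
  proof (intro approx_step approx_sum approx_cscale)
    fix j \<nu> assume j: "j \<in> {1..<i}"
    then have i2: "i \<in> {2..3}" and j3: "j \<in> {1..3}" using i by auto
    show "approx 1 (\<lambda>h. W i \<nu> h *\<^sub>R G \<nu> (U h j)) (\<lambda>h. 1 *\<^sub>R G \<nu> u)"
      using W_1[OF i2] part_1[OF j3] hO_const part_bounded[OF j3] by (rule approx_scaleR)
  qed
  finally show ?thesis
    by (simp add: explicit_rk_3_sum[OF rk i] F_def scaleR_sum_left scaleR_sum_right sum.swap[of _ _ UNIV] numeral_2_eq_2)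
qed

lemma part_2:
  assumes i: "i \<in> {1..3}"
  shows "approx 2 (\<lambda>h. G \<nu> (U h i)) (\<lambda>h. G \<nu> u + h *\<^sub>R (c i *\<^sub>R D \<nu> (F u)))"
proof -
  have "approx 2 (\<lambda>h. G \<nu> (U h i)) (\<lambda>h. G \<nu> u + D \<nu> (U h i - u))"
    by (rule taylor2_approx_2[OF taylor stage_1[OF i]])
  also have "approx 2 (\<lambda>h. U h i - u) (\<lambda>h. h *\<^sub>R (c i *\<^sub>R F u))"
    using stage_2[OF i] by (simp add: approx_def algebra_simps)
  then have "approx 2 (\<lambda>h. G \<nu> u + D \<nu> (U h i - u)) (\<lambda>h. G \<nu> u + D \<nu> (h *\<^sub>R (c i *\<^sub>R F u)))"
    by (intro approx_add approx_refl approx_linear[OF D_linear])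
  finally show ?thesis
    by (simp add: linear_cmul[OF bounded_linear.linear[OF D_linear]])
qed

text \<open>The weights of the stages act on \<open>z\<close> only after two factors
  \<open>h\<close>, so their order 1 is enough for order 3. For a production-destruction system the
  resulting polynomial is \<open>NB2\<close>.\<close>

lemma update_3:
  assumes V: "\<And>\<nu>. approx 2 (V \<nu>) (\<lambda>h. 1)"
    and b: "(\<Sum>j=1..3. b j) = 1" "b 2 * c 2 + b 3 * c 3 = 1 / 2"
  shows "approx 3 z (\<lambda>h. u + h *\<^sub>R F u + (h\<^sup>2 / 2) *\<^sub>R DF (F u))"
proof -
  have "(\<Sum>j=1..3. b j *\<^sub>R (\<Sum>\<nu>\<in>UNIV. G \<nu> u + h *\<^sub>R (c j *\<^sub>R D \<nu> (F u)))) =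
      (\<Sum>j=1..3. b j) *\<^sub>R F u + (h * (b 2 * c 2 + b 3 * c 3)) *\<^sub>R DF (F u)" for h
    unfolding stage_sets
    by (simp add: explicit_rk_3D(1)[OF rk, unfolded One_nat_def] sum.distrib algebra_simps F_def DF_def flip: scaleR_sum_right)
  then have "(\<lambda>h. u + h *\<^sub>R (\<Sum>j=1..3. b j *\<^sub>R (\<Sum>\<nu>\<in>UNIV. G \<nu> u + h *\<^sub>R (c j *\<^sub>R D \<nu> (F u))))) =
      (\<lambda>h. u + h *\<^sub>R F u + (h\<^sup>2 / 2) *\<^sub>R DF (F u))"
    unfolding b by (simp add: algebra_simps power2_eq_square)
  moreover have "approx (Suc 2) z (\<lambda>h. u + h *\<^sub>R (\<Sum>j=1..3. b j *\<^sub>R (\<Sum>\<nu>\<in>UNIV. G \<nu> u + h *\<^sub>R (c j *\<^sub>R D \<nu> (F u)))))"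
    by (rule update_approx[OF V part_2])
  ultimately show ?thesis by simp
qed

text \<open>The quadratic term \<open>BF\<close> tolerates stages known up to \<open>O(h^2)\<close>.
  The linear map \<open>DF\<close> is pulled out of the sum over the stages, so that only the sum of
  \<open>b j *\<^sub>R (U h j - u)\<close> must be known up to \<open>O(h^3)\<close>, and there
  \<open>W_2\<close> supplies the missing order.\<close>

lemma update_4:
  assumes V: "\<And>\<nu>. approx 3 (V \<nu>) (\<lambda>h. 1)"
    and W_2: "\<And>\<nu>. approx 2 (\<lambda>h. b 2 * c 2 * W 2 \<nu> h + b 3 * c 3 * W 3 \<nu> h) (\<lambda>h. 1 / 2)"
    and b: "(\<Sum>j=1..3. b j) = 1" "b 2 * (c 2)\<^sup>2 + b 3 * (c 3)\<^sup>2 = 1 / 3" "b 3 * A 3 2 * c 2 = 1 / 6"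
  shows "approx 4 z (\<lambda>h. u + h *\<^sub>R F u + (h\<^sup>2 / 2) *\<^sub>R DF (F u) +
    h ^ 3 *\<^sub>R ((1 / 6) *\<^sub>R DF (DF (F u)) + (1 / 3) *\<^sub>R BF (F u) (F u)))"
proof -
  note linD = bounded_linear.linear[OF D_linear] bounded_linear.linear[OF DF_linear]
  note cs = explicit_rk_3D[OF rk]
  have stages: "(1::nat) \<in> {1..3}" "(2::nat) \<in> {1..3}" "(3::nat) \<in> {1..3}" "(2::nat) \<in> {2..3}" "(3::nat) \<in> {2..3}"
    by auto
  \<comment> \<open>The weight is kept in front of \<open>G \<nu> u\<close> and replaced by
    \<open>1\<close> only where a factor \<open>h\<close> is already present, which loses nothing at
    order 2.\<close>
  have WG: "approx 2 (\<lambda>h. W i \<nu> h *\<^sub>R G \<nu> (U h j)) (\<lambda>h. W i \<nu> h *\<^sub>R G \<nu> u + h *\<^sub>R (c j *\<^sub>R D \<nu> (F u)))"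
    if i: "i \<in> {2..3}" and j: "j \<in> {1..3}" for i j \<nu>
  proof -
    have "approx 2 (\<lambda>h. W i \<nu> h *\<^sub>R G \<nu> (U h j)) (\<lambda>h. W i \<nu> h *\<^sub>R (G \<nu> u + h *\<^sub>R (c j *\<^sub>R D \<nu> (F u))))"
      using approx_refl part_2[OF j] W_bounded[OF i] part_bounded[OF j] by (rule approx_scaleR)
    also have "\<dots> = (\<lambda>h. W i \<nu> h *\<^sub>R G \<nu> u + h *\<^sub>R (W i \<nu> h *\<^sub>R (c j *\<^sub>R D \<nu> (F u))))"
      by (simp add: fun_eq_iff algebra_simps)
    also have "approx (Suc 1) \<dots> (\<lambda>h. W i \<nu> h *\<^sub>R G \<nu> u + h *\<^sub>R (1 *\<^sub>R (c j *\<^sub>R D \<nu> (F u))))"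
      by (intro approx_add approx_refl approx_shift approx_scaleR W_1 i hO_const)
    then have "approx 2 (\<lambda>h. W i \<nu> h *\<^sub>R G \<nu> u + h *\<^sub>R (W i \<nu> h *\<^sub>R (c j *\<^sub>R D \<nu> (F u))))
        (\<lambda>h. W i \<nu> h *\<^sub>R G \<nu> u + h *\<^sub>R (c j *\<^sub>R D \<nu> (F u)))"
      by (simp add: numeral_2_eq_2)
    finally show ?thesis .
  qed
  \<comment> \<open>The contribution of colour \<open>\<nu>\<close> to the sum of
    \<open>b j *\<^sub>R (U h j - u)\<close>, divided by \<open>h\<close>. The row sums of
    \<open>A\<close> collect the weights in front of \<open>G \<nu> u\<close> into the combination
    that \<open>W_2\<close> controls.\<close>
  define P where "P \<nu> h = (b 2 * A 2 1) *\<^sub>R (W 2 \<nu> h *\<^sub>R G \<nu> (U h 1)) + (b 3 * A 3 1) *\<^sub>R (W 3 \<nu> h *\<^sub>R G \<nu> (U h 1)) +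
        (b 3 * A 3 2) *\<^sub>R (W 3 \<nu> h *\<^sub>R G \<nu> (U h 2))" for \<nu> h
  have P: "approx 2 (P \<nu>) (\<lambda>h. (1 / 2) *\<^sub>R G \<nu> u + (h / 6) *\<^sub>R D \<nu> (F u))" for \<nu>
  proof -
    have "approx 2 (P \<nu>) (\<lambda>h. (b 2 * A 2 1) *\<^sub>R (W 2 \<nu> h *\<^sub>R G \<nu> u + h *\<^sub>R (c 1 *\<^sub>R D \<nu> (F u))) +
        (b 3 * A 3 1) *\<^sub>R (W 3 \<nu> h *\<^sub>R G \<nu> u + h *\<^sub>R (c 1 *\<^sub>R D \<nu> (F u))) +
        (b 3 * A 3 2) *\<^sub>R (W 3 \<nu> h *\<^sub>R G \<nu> u + h *\<^sub>R (c 2 *\<^sub>R D \<nu> (F u))))"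
      unfolding P_def by (intro approx_add approx_cscale WG stages)
    also have "\<dots> = (\<lambda>h. (b 2 * c 2 * W 2 \<nu> h + b 3 * c 3 * W 3 \<nu> h) *\<^sub>R G \<nu> u +
        (h * (b 3 * A 3 2 * c 2)) *\<^sub>R D \<nu> (F u))"
      unfolding cs by (simp add: fun_eq_iff algebra_simps)
    also have "approx 2 \<dots> (\<lambda>h. (1 / 2) *\<^sub>R G \<nu> u + (h * (b 3 * A 3 2 * c 2)) *\<^sub>R D \<nu> (F u))"
      by (intro approx_add approx_refl approx_scaleR W_2 hO_const)
    finally show ?thesis by (simp add: b(3))
  qed
  have S: "approx 3 (\<lambda>h. \<Sum>j=1..3. b j *\<^sub>R (U h j - u)) (\<lambda>h. h *\<^sub>R ((1 / 2) *\<^sub>R F u + (h / 6) *\<^sub>R DF (F u)))"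
  proof -
    have "\<forall>\<^sub>F h in at_right 0. (\<Sum>j=1..3. b j *\<^sub>R (U h j - u)) = h *\<^sub>R (\<Sum>\<nu>\<in>UNIV. P \<nu> h)"
      using stage_eq[OF stages(1)] stage_eq[OF stages(2)] stage_eq[OF stages(3)]
      by eventually_elim
        (simp add: stage_sets[unfolded One_nat_def] P_def sum.distrib scaleR_sum_right algebra_simps)
    then have "approx 3 (\<lambda>h. \<Sum>j=1..3. b j *\<^sub>R (U h j - u)) (\<lambda>h. h *\<^sub>R (\<Sum>\<nu>\<in>UNIV. P \<nu> h))"
      by (rule approx_eventually_eq)
    also have "approx (Suc 2) (\<lambda>h. h *\<^sub>R (\<Sum>\<nu>\<in>UNIV. P \<nu> h)) (\<lambda>h. h *\<^sub>R (\<Sum>\<nu>\<in>UNIV. (1 / 2) *\<^sub>R G \<nu> u + (h / 6) *\<^sub>R D \<nu> (F u)))"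
      by (intro approx_shift approx_sum P)
    then have "approx 3 (\<lambda>h. h *\<^sub>R (\<Sum>\<nu>\<in>UNIV. P \<nu> h)) (\<lambda>h. h *\<^sub>R ((1 / 2) *\<^sub>R F u + (h / 6) *\<^sub>R DF (F u)))"
      by (simp add: sum.distrib F_def DF_def flip: scaleR_sum_right)
    finally show ?thesis .
  qed
  have FU: "approx 3 (\<lambda>h. F (U h j)) (\<lambda>h. F u + DF (U h j - u) + (h\<^sup>2 * (c j)\<^sup>2) *\<^sub>R BF (F u) (F u))"
    if j: "j \<in> {1..3}" for j
  proof -
    define X where "X h = U h j - u" for h
    have X: "hO 1 X" "hO 2 (\<lambda>h. X h - h *\<^sub>R (c j *\<^sub>R F u))"
      using stage_1[OF j] stage_2[OF j] by (auto simp: approx_def X_def[abs_def] algebra_simps)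
    have 1: "hO (2 + 1) (\<lambda>h. BF (X h - h *\<^sub>R (c j *\<^sub>R F u)) (X h))"
      by (rule hO_prod[OF BF_bilinear X(2,1)])
    have "hO 1 (\<lambda>h. h *\<^sub>R (c j *\<^sub>R F u))"
      unfolding One_nat_def by (rule hO_shift[OF hO_const])
    then have 2: "hO (1 + 2) (\<lambda>h. BF (h *\<^sub>R (c j *\<^sub>R F u)) (X h - h *\<^sub>R (c j *\<^sub>R F u)))"
      using X(2) by (rule hO_prod[OF BF_bilinear])
    have "approx 3 (\<lambda>h. BF (X h) (X h)) (\<lambda>h. BF (h *\<^sub>R (c j *\<^sub>R F u)) (h *\<^sub>R (c j *\<^sub>R F u)))"
      unfolding approx_def using hO_add[OF 1 2[unfolded add.commute[of 1]]]
      by (simp add: bounded_bilinear.diff_left[OF BF_bilinear] bounded_bilinear.diff_right[OF BF_bilinear])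
    then have "approx 3 (\<lambda>h. BF (X h) (X h)) (\<lambda>h. (h\<^sup>2 * (c j)\<^sup>2) *\<^sub>R BF (F u) (F u))"
      by (simp add: bounded_bilinear.scaleR_left[OF BF_bilinear] bounded_bilinear.scaleR_right[OF BF_bilinear]
          power2_eq_square mult_ac)
    then have "approx 3 (\<lambda>h. F u + DF (X h) + BF (X h) (X h)) (\<lambda>h. F u + DF (X h) + (h\<^sup>2 * (c j)\<^sup>2) *\<^sub>R BF (F u) (F u))"
      by (intro approx_add approx_refl)
    with taylor2_approx_3[OF taylor_F stage_1[OF j]] show ?thesis
      unfolding X_def by (rule approx_trans)
  qed
  have "approx (Suc 3) z (\<lambda>h. u + h *\<^sub>R (\<Sum>j=1..3. b j *\<^sub>R (\<Sum>\<nu>\<in>UNIV. G \<nu> (U h j))))"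
    by (rule update_approx[OF V approx_refl])
  also have "\<dots> = (\<lambda>h. u + h *\<^sub>R (\<Sum>j=1..3. b j *\<^sub>R F (U h j)))"
    by (simp add: F_def)
  also have "approx (Suc 3) \<dots> (\<lambda>h. u + h *\<^sub>R (\<Sum>j=1..3. b j *\<^sub>R (F u + DF (U h j - u) + (h\<^sup>2 * (c j)\<^sup>2) *\<^sub>R BF (F u) (F u))))"
    by (intro approx_step approx_sum approx_cscale FU)
  also have "\<dots> = (\<lambda>h. u + h *\<^sub>R (F u + DF (\<Sum>j=1..3. b j *\<^sub>R (U h j - u)) + (h\<^sup>2 / 3) *\<^sub>R BF (F u) (F u)))"
  proof
    fix h
    have "(\<Sum>j=1..3. b j *\<^sub>R (F u + DF (U h j - u) + (h\<^sup>2 * (c j)\<^sup>2) *\<^sub>R BF (F u) (F u))) =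
        (\<Sum>j=1..3. b j) *\<^sub>R F u + (\<Sum>j=1..3. b j *\<^sub>R DF (U h j - u)) + (h\<^sup>2 * (b 2 * (c 2)\<^sup>2 + b 3 * (c 3)\<^sup>2)) *\<^sub>R BF (F u) (F u)"
      unfolding stage_sets using cs(1) by (simp add: algebra_simps)
    also have "(\<Sum>j=1..3. b j *\<^sub>R DF (U h j - u)) = DF (\<Sum>j=1..3. b j *\<^sub>R (U h j - u))"
      by (simp add: linear_sum[OF linD(2)] linear_cmul[OF linD(2)])
    finally show "u + h *\<^sub>R (\<Sum>j=1..3. b j *\<^sub>R (F u + DF (U h j - u) + (h\<^sup>2 * (c j)\<^sup>2) *\<^sub>R BF (F u) (F u))) =
        u + h *\<^sub>R (F u + DF (\<Sum>j=1..3. b j *\<^sub>R (U h j - u)) + (h\<^sup>2 / 3) *\<^sub>R BF (F u) (F u))"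
      by (simp only: b(1,2)) simp
  qed
  also have "approx (Suc 3) \<dots> (\<lambda>h. u + h *\<^sub>R (F u + DF (h *\<^sub>R ((1 / 2) *\<^sub>R F u + (h / 6) *\<^sub>R DF (F u))) + (h\<^sup>2 / 3) *\<^sub>R BF (F u) (F u)))"
    by (intro approx_step approx_add approx_refl approx_linear[OF DF_linear] S)
  also have "\<dots> = (\<lambda>h. u + h *\<^sub>R F u + (h\<^sup>2 / 2) *\<^sub>R DF (F u) +
    h ^ 3 *\<^sub>R ((1 / 6) *\<^sub>R DF (DF (F u)) + (1 / 3) *\<^sub>R BF (F u) (F u)))"
    by (simp add: fun_eq_iff linear_add[OF linD(2)] linear_cmul[OF linD(2)] algebra_simps power2_eq_square power3_eq_cube)
  finally show ?thesis by simp
qed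

end

end

section \<open>Necessary order conditions\<close>

text \<open>Differentiation keeps the shape: it shifts \<open>j\<close> by one and rescales
  \<open>a\<close> by a coordinate of the direction. Hence the induction runs over all
  \<open>j\<close> and \<open>a\<close> at once.\<close>

lemma C_k_coordinate:
  fixes f :: "nat \<Rightarrow> real \<Rightarrow> real" and a :: "'b::real_normed_vector"
  assumes der: "\<And>j x. (f j has_real_derivative f (Suc j) x) (at x)"
  shows "C_k k UNIV (\<lambda>x::real^'n. f j (x $ i) *\<^sub>R a)"
proof (induction k arbitrary: j a)
  have D: "((\<lambda>x. f j (x $ i) *\<^sub>R a) has_derivative (\<lambda>v. (v $ i * f (Suc j) (x $ i)) *\<^sub>R a)) (at x)"
    for j and a :: 'b and x :: "real^'n"
  proof -
    have "((\<lambda>x. x $ i) has_derivative (\<lambda>v. v $ i)) (at x)"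
      by (rule bounded_linear_imp_has_derivative[OF bounded_linear_vec_nth])
    from DERIV_compose_FDERIV[OF der this] show ?thesis
      by (rule has_derivative_scaleR_left)
  qed
  {
    case 0
    show ?case
      using D by (auto intro!: continuous_at_imp_continuous_on has_derivative_continuous)
  next
    case (Suc k)
    have "(\<lambda>x. frechet_derivative (\<lambda>x. f j (x $ i) *\<^sub>R a) (at x) v) =
        (\<lambda>x. f (Suc j) (x $ i) *\<^sub>R (v $ i *\<^sub>R a))" for v
      using frechet_derivative_at[OF D[of j a]] by (auto simp: fun_eq_iff mult.commute dest: fun_cong)
    then have "C_k k UNIV (\<lambda>x. frechet_derivative (\<lambda>x. f j (x $ i) *\<^sub>R a) (at x) v)" for v
      by (simp only: Suc.IH)
    then show ?case
      using D[of j a] by (auto simp only: C_k.simps differentiable_def)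
  }
qed

text \<open>Test systems for \<open>additive_order_at_least\<close> must be globally Lipschitz; a
  bounded derivative of the scalar profile provides this.\<close>

lemma lipschitz_coordinate:
  fixes f f' :: "real \<Rightarrow> real" and a :: "'b::real_normed_vector"
  assumes der: "\<And>x. (f has_real_derivative f' x) (at x)" and bound: "\<And>x. \<bar>f' x\<bar> \<le> L"
  shows "lipschitz UNIV (\<lambda>x::real^'n. f (x $ i) *\<^sub>R a)"
  unfolding lipschitz_def
proof (intro exI lipschitz_onI)
  have L: "0 \<le> L" using bound[of 0] by linarith
  then show "0 \<le> L * norm a" by simp
  fix x y :: "real^'n"
  have "\<bar>f (x $ i) - f (y $ i)\<bar> \<le> L * \<bar>x $ i - y $ i\<bar>"
    using field_differentiable_bound[of UNIV f f' L "x $ i" "y $ i"] der bound by simp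
  also have "\<dots> \<le> L * norm (x - y)"
    using component_le_norm_cart[of "x - y" i] L by (intro mult_left_mono) simp_all
  finally have "\<bar>f (x $ i) - f (y $ i)\<bar> * norm a \<le> L * norm (x - y) * norm a"
    by (rule mult_right_mono) simp
  then show "dist (f (x $ i) *\<^sub>R a) (f (y $ i) *\<^sub>R a) \<le> L * norm a * dist x y"
    by (simp add: dist_norm mult_ac flip: scaleR_diff_left)
qed

text \<open>Only the part of colour \<open>\<nu>\<close> is nonzero, and it moves along the \<open>\<nu>\<close>-th axis.\<close>

lemma additive_order_scalar_test:
  fixes f :: "nat \<Rightarrow> real \<Rightarrow> real" and \<nu> :: "'n::finite"
  assumes ord: "additive_order_at_least 3 3 \<alpha> \<beta>"
    and der: "\<And>j x. (f j has_real_derivative f (Suc j) x) (at x)" and bound: "\<And>x. \<bar>f 1 x\<bar> \<le> L"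
    and y: "\<And>t. (y has_real_derivative f 0 (y t)) (at t)"
    and V2: "\<And>h. V2 h = y 0 + h * (\<alpha> h 2 1 \<nu> * f 0 (y 0))"
    and V3: "\<And>h. V3 h = y 0 + h * (\<alpha> h 3 1 \<nu> * f 0 (y 0) + \<alpha> h 3 2 \<nu> * f 0 (V2 h))"
  shows "approx 4 (\<lambda>h. y 0 + h * (\<beta> h 1 \<nu> * f 0 (y 0) + \<beta> h 2 \<nu> * f 0 (V2 h) + \<beta> h 3 \<nu> * f 0 (V3 h))) y"
proof -
  define e :: "real^'n" where "e = axis \<nu> 1"
  define G where "G \<mu> x = f 0 (x $ \<nu>) *\<^sub>R (if \<mu> = \<nu> then e else 0)" for \<mu> :: 'n and x :: "real^'n"
  define U where "U h j = (if j = 1 then y 0 else if j = 2 then V2 h else V3 h) *\<^sub>R e" for h and j :: nat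
  define w where "w h = (y 0 + h * (\<beta> h 1 \<nu> * f 0 (y 0) + \<beta> h 2 \<nu> * f 0 (V2 h) + \<beta> h 3 \<nu> * f 0 (V3 h))) *\<^sub>R e" for h
  have e: "e $ \<nu> = 1" "norm e = 1" by (auto simp: e_def)
  \<comment> \<open>With arbitrary factors \<open>g\<close>, one identity serves the stages, the
    update and, for \<open>g = 1\<close>, the differential equation.\<close>
  have G_sum: "(\<Sum>\<mu>\<in>UNIV. g \<mu> *\<^sub>R G \<mu> x) = (g \<nu> * f 0 (x $ \<nu>)) *\<^sub>R e" for g x
    unfolding G_def by (subst sum.remove[of _ \<nu>]) (auto intro!: sum.neutral)
  have "\<forall>\<mu>. C_k (3 + 1) UNIV (G \<mu>) \<and> lipschitz UNIV (G \<mu>)"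
    unfolding G_def[abs_def] using der[of 0] bound
    by (intro allI conjI C_k_coordinate der lipschitz_coordinate[where f' = "f 1" and L = L]) simp_all
  moreover have "ode_solution UNIV (\<lambda>x. \<Sum>\<mu>\<in>UNIV. G \<mu> x) (\<lambda>t. y t *\<^sub>R e) 0 1"
  proof -
    have "((\<lambda>t. y t *\<^sub>R e) has_vector_derivative (\<Sum>\<mu>\<in>UNIV. G \<mu> (y t *\<^sub>R e))) (at t within X)" for t X
    proof -
      have "(\<Sum>\<mu>\<in>UNIV. G \<mu> (y t *\<^sub>R e)) = f 0 (y t) *\<^sub>R e"
        using G_sum[of "\<lambda>_. 1" "y t *\<^sub>R e"] e by simp
      moreover have "((\<lambda>t. y t *\<^sub>R e) has_vector_derivative f 0 (y t) *\<^sub>R e) (at t)"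
        using has_derivative_scaleR_left[OF y[of t, unfolded has_field_derivative_def], of e]
        by (simp add: has_vector_derivative_def mult.commute)
      ultimately show ?thesis by (simp add: has_vector_derivative_at_within)
    qed
    then show ?thesis by (simp add: ode_solution_def)
  qed
  moreover have "\<forall>\<^sub>F h in at_right 0. additive_step 3 (\<alpha> h) (\<beta> h) G (y 0 *\<^sub>R e) h (U h) (w h)"
  proof (intro always_eventually allI)
    fix h
    have "i = 1 \<or> i = 2 \<or> i = 3" if "i \<in> {1..3}" for i :: nat using that by auto
    moreover have "{1..<1::nat} = {}" "{1..<2::nat} = {1}" "{1..<3::nat} = {1, 2}" "{1..3::nat} = {1, 2, 3}"
      by auto
    ultimately show "additive_step 3 (\<alpha> h) (\<beta> h) G (y 0 *\<^sub>R e) h (U h) (w h)"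
      unfolding additive_step_def G_sum
      by (auto simp: U_def w_def e V2[of h] V3[of h] algebra_simps)
  qed
  ultimately have "(\<lambda>h. norm (w h - y (0 + h) *\<^sub>R e)) \<in> O[at_right 0](\<lambda>h. h ^ (3 + 1))"
    using ord unfolding additive_order_at_least_def by blast
  then show ?thesis
    by (simp add: approx_def hO_def w_def e flip: scaleR_diff_left)
qed


text \<open>On a linear equation the step is a cubic polynomial in \<open>h * l\<close> with these
  three sums as coefficients, so one family of equations yields all three; the bushy tree is
  invisible to it.\<close>

lemma additive_order_conditions:
  fixes \<nu> :: "'n::finite"
  assumes ord: "additive_order_at_least 3 3 \<alpha> \<beta>"
  shows "approx 3 (\<lambda>h. \<beta> h 1 \<nu> + \<beta> h 2 \<nu> + \<beta> h 3 \<nu>) (\<lambda>h. 1)" (is "approx 3 ?S1 _")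
    and "approx 2 (\<lambda>h. \<beta> h 2 \<nu> * \<alpha> h 2 1 \<nu> + \<beta> h 3 \<nu> * (\<alpha> h 3 1 \<nu> + \<alpha> h 3 2 \<nu>)) (\<lambda>h. 1 / 2)" (is "approx 2 ?S2 _")
    and "approx 1 (\<lambda>h. \<beta> h 3 \<nu> * \<alpha> h 3 2 \<nu> * \<alpha> h 2 1 \<nu>) (\<lambda>h. 1 / 6)" (is "approx 1 ?S3 _")
proof -
  txt \<open>The linear parts \<open>x \<mapsto> l * x\<close> with \<open>l = 1, -1, 2\<close> separate the three conditions.\<close>
  define E where "E l h = h * l * (?S1 h - 1) + h\<^sup>2 * l\<^sup>2 * (?S2 h - 1 / 2) + h ^ 3 * l ^ 3 * (?S3 h - 1 / 6)" for l h
  \<comment> \<open>\<open>E l\<close> is the numerical polynomial minus the cubic Taylor polynomial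
    of the solution \<open>exp (l * h)\<close>. The remainder of \<open>exp\<close> enters as an
    assumption, discharged below for each numerical \<open>l\<close>.\<close>
  have E: "hO 4 (E l)" if exp: "approx 4 (\<lambda>h. exp (l * h)) (\<lambda>h. 1 + l * h + (l * h)\<^sup>2 / 2 + (l * h) ^ 3 / 6)" for l
  proof -
    define f :: "nat \<Rightarrow> real \<Rightarrow> real" where "f j x = (if j = 0 then l * x else if j = 1 then l else 0)" for j x
    define V2 where "V2 h = 1 + h * (\<alpha> h 2 1 \<nu> * l)" for h
    define V3 where "V3 h = 1 + h * (\<alpha> h 3 1 \<nu> * l + \<alpha> h 3 2 \<nu> * (l * V2 h))" for h
    have f: "f 0 = (\<lambda>x. l * x)" "f 1 = (\<lambda>x. l)" "f (Suc (Suc j)) = (\<lambda>x. 0)" for j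
      by (auto simp: f_def)
    have der: "(f j has_real_derivative f (Suc j) x) (at x)" for j x
    proof (cases j)
      case 0
      then show ?thesis using f(2) by (auto simp: f(1) intro!: derivative_eq_intros)
    next
      case (Suc m)
      then show ?thesis using f(2) by (cases m) (auto simp: f(3))
    qed
    have "approx 4 (\<lambda>h. exp (l * 0) + h * (\<beta> h 1 \<nu> * f 0 (exp (l * 0)) + \<beta> h 2 \<nu> * f 0 (V2 h) + \<beta> h 3 \<nu> * f 0 (V3 h))) (\<lambda>h. exp (l * h))"
      by (rule additive_order_scalar_test[where f = f and y = "\<lambda>h. exp (l * h)" and L = "\<bar>l\<bar>" and ?V2.0 = V2 and ?V3.0 = V3, OF ord der])
         (auto simp: f(1) f(2)[unfolded One_nat_def] V2_def V3_def intro!: derivative_eq_intros)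
    from approx_trans[OF this exp]
    have "hO 4 (\<lambda>h. exp (l * 0) + h * (\<beta> h 1 \<nu> * f 0 (exp (l * 0)) + \<beta> h 2 \<nu> * f 0 (V2 h) + \<beta> h 3 \<nu> * f 0 (V3 h)) -
        (1 + l * h + (l * h)\<^sup>2 / 2 + (l * h) ^ 3 / 6))"
      by (simp add: approx_def)
    then show ?thesis
      by (rule hO_eqI) (simp add: E_def f(1) V2_def V3_def field_simps power2_eq_square power3_eq_cube)
  qed
  have E_1: "hO 4 (E 1)"
    by (rule E) (unfold approx_def hO_real_iff, real_asymp)
  have E_m1: "hO 4 (E (-1))"
    by (rule E) (unfold approx_def hO_real_iff, real_asymp)
  have E_2: "hO 4 (E 2)"
    by (rule E) (unfold approx_def hO_real_iff, real_asymp)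
  note E3 = E_1 E_m1 E_2
  \<comment> \<open>The coefficients of \<open>l\<close> and \<open>l^2\<close> cancel because
    \<open>2 - 3 + 1 = 0\<close> and \<open>4 - 3 - 1 = 0\<close>, while the cubic one is multiplied
    by \<open>8 - 3 + 1 = 6\<close>. The even and odd parts of \<open>E\<close> then give the other
    two.\<close>
  have "hO 4 (\<lambda>h. (1 / 6) * (E 2 h - 3 * E 1 h - E (-1) h))"
    by (intro hO_cmult hO_diff E3)
  then have R: "hO 4 (\<lambda>h. h ^ 3 *\<^sub>R (?S3 h - 1 / 6))"
    by (rule hO_eqI) (simp add: E_def field_simps)
  have "hO 4 (\<lambda>h. (1 / 2) * (E 1 h + E (-1) h))"
    by (intro hO_cmult hO_add E3)
  then have Q: "hO 4 (\<lambda>h. h ^ 2 *\<^sub>R (?S2 h - 1 / 2))"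
    by (rule hO_eqI) (simp add: E_def field_simps)
  have "hO 4 (\<lambda>h. (1 / 2) * (E 1 h - E (-1) h) - (1 / 6) * (E 2 h - 3 * E 1 h - E (-1) h))"
    by (intro hO_cmult hO_diff E3)
  then have P: "hO 4 (\<lambda>h. h ^ 1 *\<^sub>R (?S1 h - 1))"
    by (rule hO_eqI) (simp add: E_def field_simps)
  show "approx 3 ?S1 (\<lambda>h. 1)" "approx 2 ?S2 (\<lambda>h. 1 / 2)" "approx 1 ?S3 (\<lambda>h. 1 / 6)"
    unfolding approx_def using hO_cancel[of 1 3 "\<lambda>h. ?S1 h - 1"] hO_cancel[of 2 2 "\<lambda>h. ?S2 h - 1 / 2"]
      hO_cancel[of 3 1 "\<lambda>h. ?S3 h - 1 / 6"] P Q R by simp_all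
qed

lemma approx_cos:
  fixes X :: "real \<Rightarrow> real"
  assumes "hO 1 X"
  shows "approx 3 (\<lambda>h. cos (X h)) (\<lambda>h. 1 - (X h)\<^sup>2 / 2)"
proof -
  have bound: "\<bar>cos x - (1 - x\<^sup>2 / 2)\<bar> \<le> \<bar>x\<bar> ^ 3" for x :: real
  proof -
    obtain t where "cos x = (\<Sum>m<3. cos_coeff m * x ^ m) + (cos (t + 1 / 2 * real 3 * pi) / fact 3) * x ^ 3"
      using Maclaurin_cos_expansion[of x 3] by blast
    then have "cos x - (1 - x\<^sup>2 / 2) = (cos (t + 1 / 2 * real 3 * pi) / fact 3) * x ^ 3"
      by (simp add: cos_coeff_def numeral_3_eq_3 power2_eq_square)
    then have "\<bar>cos x - (1 - x\<^sup>2 / 2)\<bar> = (\<bar>cos (t + 1 / 2 * real 3 * pi)\<bar> / fact 3) * \<bar>x\<bar> ^ 3"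
      by (simp add: abs_mult power_abs)
    also have "\<dots> \<le> 1 * \<bar>x\<bar> ^ 3"
    proof (rule mult_right_mono)
      have "\<bar>cos (t + 1 / 2 * real 3 * pi)\<bar> / fact 3 \<le> 1 / fact 3"
        by (intro divide_right_mono abs_cos_le_one) simp
      also have "\<dots> \<le> (1::real)" by simp
      finally show "\<bar>cos (t + 1 / 2 * real 3 * pi)\<bar> / fact 3 \<le> 1" .
    qed simp
    finally show ?thesis by simp
  qed
  obtain C where C: "C > 0" "\<forall>\<^sub>F h in at_right 0. norm (X h) \<le> C * h ^ 1"
    using assms by (rule hOE)
  have "\<forall>\<^sub>F h in at_right 0. norm (cos (X h) - (1 - (X h)\<^sup>2 / 2)) \<le> C ^ 3 * h ^ 3"
    using C(2)
  proof eventually_elim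
    case (elim h)
    then have "\<bar>X h\<bar> ^ 3 \<le> (C * h) ^ 3" by (intro power_mono) auto
    with bound[of "X h"] show ?case by (simp add: power_mult_distrib)
  qed
  then show ?thesis unfolding approx_def by (rule hOI)
qed

text \<open>An equation with nonzero second derivative is needed to see this tree. The coefficients
  multiply the remainders of the cosine, hence the demand that they be bounded.\<close>

lemma additive_order_condition_bushy:
  fixes \<nu> :: "'n::finite"
  assumes ord: "additive_order_at_least 3 3 \<alpha> \<beta>"
    and \<alpha>: "hO 0 (\<lambda>h. \<alpha> h 2 1 \<nu>)" "hO 0 (\<lambda>h. \<alpha> h 3 1 \<nu>)" "hO 0 (\<lambda>h. \<alpha> h 3 2 \<nu>)"
    and \<beta>: "hO 0 (\<lambda>h. \<beta> h 2 \<nu>)" "hO 0 (\<lambda>h. \<beta> h 3 \<nu>)"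
  shows "approx 1 (\<lambda>h. \<beta> h 2 \<nu> * (\<alpha> h 2 1 \<nu>)\<^sup>2 + \<beta> h 3 \<nu> * (\<alpha> h 3 1 \<nu> + \<alpha> h 3 2 \<nu>)\<^sup>2) (\<lambda>h. 1 / 3)"
proof -
  txt \<open>The equation \<open>y' = cos y\<close> with \<open>y 0 = 0\<close> isolates the bushy tree, because the derivative of
    \<open>cos\<close> vanishes at \<open>0\<close>.\<close>
  define f :: "nat \<Rightarrow> real \<Rightarrow> real" where "f j x = cos (x + j * (pi / 2))" for j x
  \<comment> \<open>The Gudermannian function: its derivative \<open>1 / cosh t\<close> equals
    \<open>cos (arctan (sinh t))\<close>.\<close>
  define y :: "real \<Rightarrow> real" where "y t = arctan (sinh t)" for t
  define V2 where "V2 h = h * \<alpha> h 2 1 \<nu>" for h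
  define V3 where "V3 h = h * (\<alpha> h 3 1 \<nu> + \<alpha> h 3 2 \<nu> * cos (V2 h))" for h
  \<comment> \<open>The phase shift by \<open>pi / 2\<close> lists all derivatives of the cosine in
    one formula.\<close>
  have der: "(f j has_real_derivative f (Suc j) x) (at x)" for j x
  proof -
    have "f (Suc j) x = cos (x + j * (pi / 2) + pi / 2)"
      by (simp add: f_def algebra_simps add_divide_distrib)
    also have "\<dots> = - sin (x + j * (pi / 2))"
      by (simp add: cos_add)
    finally show ?thesis
      unfolding f_def by (auto intro!: derivative_eq_intros)
  qed
  have cos_y: "cos (y t) = 1 / cosh t" for t
  proof -
    have "sqrt (1 + (sinh t)\<^sup>2) = cosh t"
      using cosh_square_eq[of t] by (simp add: add.commute real_sqrt_unique)
    then show ?thesis by (simp add: y_def cos_arctan)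
  qed
  have y_der: "(y has_real_derivative f 0 (y t)) (at t)" for t
  proof -
    have "cosh t \<noteq> 0" using cosh_real_pos[of t] by simp
    moreover have "1 + (sinh t)\<^sup>2 = (cosh t)\<^sup>2" using cosh_square_eq[of t] by simp
    ultimately show ?thesis
      unfolding f_def cos_y unfolding y_def
      by (auto intro!: derivative_eq_intros simp: cos_y[unfolded y_def] power2_eq_square field_simps)
  qed
  have V2: "hO 1 V2" using hO_mult[OF hO_id(1) \<alpha>(1)] by (simp add: V2_def[abs_def])
  have cos_V2: "approx 2 (\<lambda>h. cos (V2 h)) (\<lambda>h. 1)"
  proof -
    have "hO 2 (\<lambda>h. (1 / 2) * (V2 h * V2 h))"
      using hO_mult[OF V2 V2] by (intro hO_cmult) (simp add: one_add_one del: One_nat_def)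
    then have "approx 2 (\<lambda>h. 1 - (V2 h)\<^sup>2 / 2) (\<lambda>h. 1)"
      using hO_minus by (fastforce simp: approx_def power2_eq_square)
    with approx_mono[OF approx_cos[OF V2], of 2] show ?thesis by (auto intro: approx_trans)
  qed
  define g where "g h = \<alpha> h 3 1 \<nu> + \<alpha> h 3 2 \<nu>" for h
  have g: "hO 0 g" unfolding g_def[abs_def] by (intro hO_add \<alpha>)
  \<comment> \<open>The cosine is flat at \<open>0\<close>, so the second stage alters the third
    only by \<open>h\<close> times \<open>O(h^2)\<close>; this keeps the tall tree out of the
    result.\<close>
  have V3: "approx 3 V3 (\<lambda>h. h * g h)"
  proof -
    have "hO (1 + (0 + 2)) (\<lambda>h. h * (\<alpha> h 3 2 \<nu> * (cos (V2 h) - 1)))"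
      using cos_V2 by (intro hO_mult \<alpha> hO_id) (simp add: approx_def)
    then show ?thesis by (simp add: approx_def V3_def g_def algebra_simps numeral_3_eq_3)
  qed
  have hg: "hO 1 (\<lambda>h. h * g h)" using hO_mult[OF hO_id(1) g] by simp
  have V3_1: "hO 1 V3"
    using hO_add[OF hO_mono[OF V3[unfolded approx_def], of 1] hg] by simp
  have V3_sq: "approx 3 (\<lambda>h. (V3 h)\<^sup>2) (\<lambda>h. (h * g h)\<^sup>2)"
  proof -
    have "hO (3 + 0) (\<lambda>h. (V3 h - h * g h) * (V3 h + h * g h))"
      using V3 V3_1 hg by (intro hO_mult hO_add) (auto simp: approx_def intro: hO_mono)
    then show ?thesis by (simp add: approx_def power2_eq_square algebra_simps)
  qed
  have "approx 3 (\<lambda>h. 1 - (V3 h)\<^sup>2 / 2) (\<lambda>h. 1 - (h * g h)\<^sup>2 / 2)"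
    using hO_cmult[OF hO_minus[OF V3_sq[unfolded approx_def]], of "1 / 2"]
    by (simp add: approx_def algebra_simps diff_divide_distrib)
  with approx_cos[OF V3_1] have cos_V3: "approx 3 (\<lambda>h. cos (V3 h)) (\<lambda>h. 1 - (h * g h)\<^sup>2 / 2)"
    by (rule approx_trans)
  have "approx 4 (\<lambda>h. y 0 + h * (\<beta> h 1 \<nu> * f 0 (y 0) + \<beta> h 2 \<nu> * f 0 (V2 h) + \<beta> h 3 \<nu> * f 0 (V3 h))) y"
    by (rule additive_order_scalar_test[where f = f and y = y and L = 1 and ?V2.0 = V2 and ?V3.0 = V3, OF ord der _ y_der])
       (auto simp: f_def V2_def V3_def y_def)
  then have 1: "hO 4 (\<lambda>h. h * (\<beta> h 1 \<nu> + \<beta> h 2 \<nu> * cos (V2 h) + \<beta> h 3 \<nu> * cos (V3 h)) - y h)"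
    by (simp add: approx_def f_def y_def)
  have 2: "hO 4 (\<lambda>h. y h - (h - h ^ 3 / 6))"
    unfolding hO_def y_def sinh_def by simp real_asymp
  have 3: "hO (1 + (0 + 3)) (\<lambda>h. h * (\<beta> h 2 \<nu> * (cos (V2 h) - (1 - (V2 h)\<^sup>2 / 2))))"
    using approx_cos[OF V2] by (intro hO_mult \<beta> hO_id) (simp add: approx_def)
  have 4: "hO (1 + (0 + 3)) (\<lambda>h. h * (\<beta> h 3 \<nu> * (cos (V3 h) - (1 - (h * g h)\<^sup>2 / 2))))"
    using cos_V3 by (intro hO_mult \<beta> hO_id) (simp add: approx_def)
  have 5: "hO (1 + 3) (\<lambda>h. h * (\<beta> h 1 \<nu> + \<beta> h 2 \<nu> + \<beta> h 3 \<nu> - 1))"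
    using additive_order_conditions(1)[OF ord] by (intro hO_mult hO_id) (simp add: approx_def)
  have four: "1 + (0 + 3) = (4::nat)" "1 + 3 = (4::nat)" by simp_all
  \<comment> \<open>After subtracting the remainders, \<open>h^3 / 6\<close> from the expansion of
    \<open>y\<close> is left, minus half of \<open>h^3\<close> times the bushy sum. The factor
    \<open>- 2\<close> normalizes this to the sum minus \<open>1 / 3\<close>.\<close>
  have "hO 4 (\<lambda>h. (- 2) * ((h * (\<beta> h 1 \<nu> + \<beta> h 2 \<nu> * cos (V2 h) + \<beta> h 3 \<nu> * cos (V3 h)) - y h) + (y h - (h - h ^ 3 / 6)) -
      h * (\<beta> h 2 \<nu> * (cos (V2 h) - (1 - (V2 h)\<^sup>2 / 2))) - h * (\<beta> h 3 \<nu> * (cos (V3 h) - (1 - (h * g h)\<^sup>2 / 2))) -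
      h * (\<beta> h 1 \<nu> + \<beta> h 2 \<nu> + \<beta> h 3 \<nu> - 1)))"
    by (rule hO_cmult[OF hO_diff[OF hO_diff[OF hO_diff[OF hO_add[OF 1 2] 3[unfolded four]] 4[unfolded four]] 5[unfolded four]]])
  then have "hO 4 (\<lambda>h. h ^ 3 *\<^sub>R (\<beta> h 2 \<nu> * (\<alpha> h 2 1 \<nu>)\<^sup>2 + \<beta> h 3 \<nu> * (g h)\<^sup>2 - 1 / 3))"
    by (rule hO_eqI) (simp add: V2_def field_simps power2_eq_square power3_eq_cube)
  then show ?thesis
    using hO_cancel[of 3 1 "\<lambda>h. \<beta> h 2 \<nu> * (\<alpha> h 2 1 \<nu>)\<^sup>2 + \<beta> h 3 \<nu> * (g h)\<^sup>2 - 1 / 3"]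
    unfolding approx_def g_def by simp
qed

section \<open>Production-destruction systems and limits of the weights\<close>

lemma tendsto_fun_componentwise:
  fixes Y :: "'a \<Rightarrow> 'i \<Rightarrow> 'b::topological_space"
  assumes "\<And>j. ((\<lambda>h. Y h j) \<longlongrightarrow> l j) F"
  shows "(Y \<longlongrightarrow> l) F"
  using assms limitin_componentwise[of "\<lambda>i. euclidean" UNIV Y l F]
  by (simp add: euclidean_product_topology)

lemma open_pos_orthant: "open (pos_orthant :: (real^'n::finite) set)"
proof -
  have *: "(pos_orthant :: (real^'n) set) = (\<Inter>i\<in>UNIV. {y. 0 < y $ i})"
    by (auto simp: pos_orthant_def)
  show ?thesis
    unfolding * by (intro open_INT ballI open_Collect_less continuous_intros finite_class.finite_UNIV)
qed

lemma patankar_denominator_tendsto: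
  assumes g: "patankar_denominator k g" and y: "y \<in> pos_orthant"
    and Y: "\<And>j. j \<in> {1..k} \<Longrightarrow> ((\<lambda>h. Y h j) \<longlongrightarrow> y) F"
  shows "((\<lambda>h. g y (Y h)) \<longlongrightarrow> g y (\<lambda>_. y)) F"
proof -
  let ?S = "{(y, Y). y \<in> pos_orthant \<and> (\<forall>j\<in>{1..k}. Y j \<in> pos_orthant)}"
  \<comment> \<open>Convergence is known for the stages \<open>1..k\<close> only. Filling the other
    places with \<open>y\<close> makes the whole family converge in the product topology without
    changing the value of \<open>g\<close>.\<close>
  define Y' where "Y' h j = (if j \<in> {1..k} then Y h j else y)" for h j
  have pos: "\<forall>\<^sub>F h in F. Y h j \<in> pos_orthant" if "j \<in> {1..k}" for j
    using Y[OF that] open_pos_orthant y by (rule topological_tendstoD)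
  have "((\<lambda>h. Y' h j) \<longlongrightarrow> y) F" for j
    by (cases "j \<in> {1..k}") (simp_all only: Y'_def Y if_True if_False tendsto_const)
  then have "((\<lambda>h. (y, Y' h)) \<longlongrightarrow> (y, \<lambda>_. y)) F"
    by (intro tendsto_Pair tendsto_const tendsto_fun_componentwise)
  moreover have "(y, \<lambda>_. y) \<in> ?S"
    using y by auto
  moreover have "\<forall>\<^sub>F h in F. (y, Y' h) \<in> ?S"
  proof -
    have "\<forall>\<^sub>F h in F. \<forall>j\<in>{1..k}. Y h j \<in> pos_orthant"
      using pos by (intro eventually_ball_finite) auto
    then show ?thesis
      by eventually_elim (use y in \<open>auto simp: Y'_def\<close>)
  qed
  moreover have "continuous_on ?S (\<lambda>(y, Y). g y Y)"
    using g by (simp add: patankar_denominator_def)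
  ultimately have "((\<lambda>h. case (y, Y' h) of (y, Y) \<Rightarrow> g y Y) \<longlongrightarrow> (case (y, \<lambda>_. y) of (y, Y) \<Rightarrow> g y Y)) F"
    by (intro continuous_on_tendsto_compose[of ?S "\<lambda>(y, Y). g y Y"])
  then have "((\<lambda>h. g y (Y' h)) \<longlongrightarrow> g y (\<lambda>_. y)) F"
    by simp
  moreover have "g y (Y' h) = g y (Y h)" for h
  proof -
    have "\<forall>j\<in>{1..k}. Y' h j = Y h j" by (simp add: Y'_def)
    then show ?thesis using g unfolding patankar_denominator_def by blast
  qed
  ultimately show ?thesis by simp
qed

lemma patankar_denominator_cong:
  assumes "patankar_denominator k g" "\<And>j. j \<in> {1..k} \<Longrightarrow> Y j = Y' j"
  shows "g y Y = g y Y'"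
  using assms unfolding patankar_denominator_def by blast

lemma patankar_denominator_pos:
  "patankar_denominator k g \<Longrightarrow> y \<in> pos_orthant \<Longrightarrow> 0 < g y (\<lambda>_. y)"
  by (auto simp: patankar_denominator_def)

text \<open>All destruction of component \<open>m\<close> sits in the part of colour
  \<open>m\<close>, so it carries the weight \<open>r m\<close>, as in the scheme. The vanishing
  \<open>p m m\<close> lets the sum over the productions include the diagonal.\<close>

lemma pds_part_weighted_sum:
  assumes "pds p d" "x \<in> pos_orthant"
  shows "(\<Sum>\<nu>\<in>UNIV. r \<nu> *\<^sub>R pds_part p d \<nu> x) $ m = (\<Sum>\<nu>\<in>UNIV. p m \<nu> x * r \<nu> - d m \<nu> x * r m)"
proof -
  have pmm: "p m m x = 0" using assms by (auto simp: pds_def)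
  have "(\<Sum>\<nu>\<in>UNIV. r \<nu> *\<^sub>R pds_part p d \<nu> x) $ m =
      (\<Sum>\<nu>\<in>UNIV. r \<nu> * (if m = \<nu> then - (\<Sum>j\<in>UNIV. d m j x) else p m \<nu> x))"
    by (simp add: pds_part_def)
  also have "\<dots> = (\<Sum>\<nu>\<in>UNIV. p m \<nu> x * r \<nu> + (if m = \<nu> then - (\<Sum>j\<in>UNIV. d m j x) * r m else 0))"
    by (intro sum.cong) (auto simp: pmm)
  also have "\<dots> = (\<Sum>\<nu>\<in>UNIV. p m \<nu> x * r \<nu>) - (\<Sum>j\<in>UNIV. d m j x * r m)"
    by (simp add: sum.distrib sum_distrib_right)
  finally show ?thesis by (simp add: sum_subtractf)
qed

text \<open>The identities of \<open>pds\<close> hold on \<open>pos_orthant\<close>, and the parts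
  are evaluated at earlier stages only; asking positivity of just these makes the equation usable in
  an induction over the stages.\<close>

lemma mprk_stage_eq:
  assumes "mprk_step s A b p d \<rho> \<sigma> y h Y z" "pds p d" "i \<in> {1..s}"
    and "\<And>j. j \<in> {1..<i} \<Longrightarrow> Y j \<in> pos_orthant"
  shows "Y i = y + h *\<^sub>R (\<Sum>j=1..<i. \<Sum>\<nu>\<in>UNIV. A i j *\<^sub>R ((Y i $ \<nu> / \<rho> i \<nu> y Y) *\<^sub>R pds_part p d \<nu> (Y j)))"
proof (unfold vec_eq_iff, rule allI)
  fix m
  have "Y i $ m = y $ m + h * (\<Sum>j=1..<i. A i j * (\<Sum>\<nu>\<in>UNIV.
        p m \<nu> (Y j) * (Y i $ \<nu> / \<rho> i \<nu> y Y) - d m \<nu> (Y j) * (Y i $ m / \<rho> i m y Y)))"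
    using assms(1,3) unfolding mprk_step_def by blast
  also have "(\<Sum>j=1..<i. A i j * (\<Sum>\<nu>\<in>UNIV.
        p m \<nu> (Y j) * (Y i $ \<nu> / \<rho> i \<nu> y Y) - d m \<nu> (Y j) * (Y i $ m / \<rho> i m y Y))) =
      (\<Sum>j=1..<i. A i j * (\<Sum>\<nu>\<in>UNIV. (Y i $ \<nu> / \<rho> i \<nu> y Y) *\<^sub>R pds_part p d \<nu> (Y j)) $ m)"
    by (intro sum.cong refl) (simp only: pds_part_weighted_sum[OF assms(2,4)])
  finally show "Y i $ m = (y + h *\<^sub>R (\<Sum>j=1..<i. \<Sum>\<nu>\<in>UNIV. A i j *\<^sub>R ((Y i $ \<nu> / \<rho> i \<nu> y Y) *\<^sub>R pds_part p d \<nu> (Y j)))) $ m"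
    by (simp add: sum_distrib_left mult.assoc)
qed

lemma mprk_update_eq:
  assumes "mprk_step s A b p d \<rho> \<sigma> y h Y z" "pds p d"
    and "\<And>j. j \<in> {1..s} \<Longrightarrow> Y j \<in> pos_orthant"
  shows "z = y + h *\<^sub>R (\<Sum>j=1..s. \<Sum>\<nu>\<in>UNIV. b j *\<^sub>R ((z $ \<nu> / \<sigma> \<nu> y Y) *\<^sub>R pds_part p d \<nu> (Y j)))"
proof (unfold vec_eq_iff, rule allI)
  fix m
  have "z $ m = y $ m + h * (\<Sum>j=1..s. b j * (\<Sum>\<nu>\<in>UNIV.
        p m \<nu> (Y j) * (z $ \<nu> / \<sigma> \<nu> y Y) - d m \<nu> (Y j) * (z $ m / \<sigma> m y Y)))"
    using assms(1) unfolding mprk_step_def by blast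
  also have "(\<Sum>j=1..s. b j * (\<Sum>\<nu>\<in>UNIV.
        p m \<nu> (Y j) * (z $ \<nu> / \<sigma> \<nu> y Y) - d m \<nu> (Y j) * (z $ m / \<sigma> m y Y))) =
      (\<Sum>j=1..s. b j * (\<Sum>\<nu>\<in>UNIV. (z $ \<nu> / \<sigma> \<nu> y Y) *\<^sub>R pds_part p d \<nu> (Y j)) $ m)"
    by (intro sum.cong refl) (simp only: pds_part_weighted_sum[OF assms(2,3)])
  finally show "z $ m = (y + h *\<^sub>R (\<Sum>j=1..s. \<Sum>\<nu>\<in>UNIV. b j *\<^sub>R ((z $ \<nu> / \<sigma> \<nu> y Y) *\<^sub>R pds_part p d \<nu> (Y j)))) $ m"
    by (simp add: sum_distrib_left mult.assoc)
qed

text \<open>The increment is \<open>h\<close> times a linear function of the unknown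
  \<open>X h\<close> with bounded coefficients. For small \<open>h\<close> it is at most half of
  \<open>norm (X h)\<close>; thus \<open>norm (X h)\<close> is at most \<open>2 * norm y\<close> and
  the increment is \<open>O(h)\<close>.\<close>

lemma implicit_stage_approx:
  fixes X :: "real \<Rightarrow> real^'n::finite"
  assumes eq: "\<forall>\<^sub>F h in at_right 0. X h = y + h *\<^sub>R (\<Sum>j\<in>J. \<Sum>\<nu>\<in>UNIV. a j *\<^sub>R ((X h $ \<nu> / r \<nu> h) *\<^sub>R g j \<nu> h))"
    and r: "\<And>\<nu>. (r \<nu> \<longlongrightarrow> l \<nu>) (at_right 0)" "\<And>\<nu>. l \<nu> \<noteq> 0"
    and g: "\<And>j \<nu>. j \<in> J \<Longrightarrow> hO 0 (g j \<nu>)"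
  shows "approx 1 X (\<lambda>h. y)"
proof -
  define M where "M h = (\<Sum>j\<in>J. \<Sum>\<nu>\<in>UNIV. \<bar>a j\<bar> * (\<bar>inverse (r \<nu> h)\<bar> * norm (g j \<nu> h)))" for h
  have "hO 0 M"
    unfolding M_def
  proof (intro hO_sum hO_cmult)
    fix j \<nu> assume "j \<in> J"
    have "hO 0 (\<lambda>h. inverse (r \<nu> h))"
      by (rule tendsto_imp_hO[OF tendsto_inverse[OF r]])
    then have "hO (0 + 0) (\<lambda>h. \<bar>inverse (r \<nu> h)\<bar> * norm (g j \<nu> h))"
      using hO_mult[OF hO_norm[of 0 "\<lambda>h. inverse (r \<nu> h)"] hO_norm[OF g[OF \<open>j \<in> J\<close>]]] by simp
    then show "hO 0 (\<lambda>h. \<bar>inverse (r \<nu> h)\<bar> * norm (g j \<nu> h))" by simp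
  qed
  then obtain C where C: "C > 0" "\<forall>\<^sub>F h in at_right 0. norm (M h) \<le> C * h ^ 0"
    by (rule hOE)
  have small: "\<forall>\<^sub>F h in at_right 0. h < 1 / (2 * C)"
    using eventually_at_right_real[of 0 "1 / (2 * C)"] C(1) by (auto elim: eventually_mono)
  have "\<forall>\<^sub>F h in at_right 0. norm (X h - y) \<le> (2 * C * norm y) * h ^ 1"
    using eq C(2) small eventually_at_right_less[of 0]
  proof eventually_elim
    case (elim h)
    define S where "S = (\<Sum>j\<in>J. \<Sum>\<nu>\<in>UNIV. a j *\<^sub>R ((X h $ \<nu> / r \<nu> h) *\<^sub>R g j \<nu> h))"
    have "norm S \<le>
        (\<Sum>j\<in>J. \<Sum>\<nu>\<in>UNIV. (\<bar>a j\<bar> * (\<bar>inverse (r \<nu> h)\<bar> * norm (g j \<nu> h))) * norm (X h))"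
      unfolding S_def
    proof (intro sum_norm_le)
      fix j \<nu>
      have "norm (a j *\<^sub>R ((X h $ \<nu> / r \<nu> h) *\<^sub>R g j \<nu> h)) = (\<bar>a j\<bar> * (\<bar>inverse (r \<nu> h)\<bar> * norm (g j \<nu> h))) * \<bar>X h $ \<nu>\<bar>"
        by (simp add: divide_inverse abs_mult)
      also have "\<dots> \<le> (\<bar>a j\<bar> * (\<bar>inverse (r \<nu> h)\<bar> * norm (g j \<nu> h))) * norm (X h)"
        by (intro mult_left_mono component_le_norm_cart) simp
      finally show "norm (a j *\<^sub>R ((X h $ \<nu> / r \<nu> h) *\<^sub>R g j \<nu> h)) \<le> (\<bar>a j\<bar> * (\<bar>inverse (r \<nu> h)\<bar> * norm (g j \<nu> h))) * norm (X h)" .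
    qed
    also have "\<dots> = M h * norm (X h)"
      by (simp add: M_def sum_distrib_right)
    also have "\<dots> \<le> C * norm (X h)"
      using elim(2) by (intro mult_right_mono) auto
    finally have "norm S \<le> C * norm (X h)" .
    moreover have "X h - y = h *\<^sub>R S"
      using arg_cong[OF elim(1)[folded S_def], of "\<lambda>x. x - y"] by (simp only: add_diff_cancel_left')
    ultimately have 1: "norm (X h - y) \<le> h * (C * norm (X h))"
      using elim(4) by simp
    have "h * (C * norm (X h)) \<le> norm (X h) / 2"
      using elim(3) C(1) mult_right_mono[of "h * C" "1 / 2" "norm (X h)"] by (simp add: field_simps)
    with 1 have "norm (X h) \<le> 2 * norm y"
      using norm_triangle_ineq2[of "X h" y] by simp
    then have "h * (C * norm (X h)) \<le> h * (C * (2 * norm y))"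
      using elim(4) C(1) by simp
    with 1 show ?case by (simp add: mult_ac)
  qed
  then show ?thesis
    unfolding approx_def by (rule hOI)
qed

text \<open>The order conditions leave the second solution \<open>x = (b3 * c3) / (b2 * c2)\<close>, which forces
  \<open>b2 = b3\<close>; the nonnegativity of \<open>a31 = c3 - a32\<close> then gives \<open>c2 = c3\<close>, hence \<open>x = 1\<close> again.\<close>

lemma weight_limits_eq_1:
  fixes b2 b3 c2 c3 a x y :: real
  assumes nonneg: "0 \<le> b2" "0 \<le> b3" "0 \<le> c2" "0 \<le> a" "a \<le> c3"
    and rk: "b2 * c2 + b3 * c3 = 1 / 2" "b2 * c2\<^sup>2 + b3 * c3\<^sup>2 = 1 / 3" "b3 * a * c2 = 1 / 6"
    and xy: "b2 * c2 * x + b3 * c3 * y = 1 / 2" "b2 * c2\<^sup>2 * x\<^sup>2 + b3 * c3\<^sup>2 * y\<^sup>2 = 1 / 3" "x * y = 1"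
  shows "x = 1 \<and> y = 1"
proof -
  have "b3 \<noteq> 0" "a \<noteq> 0" "c2 \<noteq> 0" using rk(3) by auto
  then have pos: "b3 > 0" "a > 0" "c2 > 0" "c3 > 0" using nonneg by linarith+
  define p where "p = b2 * c2"
  define q where "q = b3 * c3"
  have q: "q > 0" using pos by (simp add: q_def)
  have pq: "p + q = 1 / 2" "p * x + q * y = p + q" using rk(1) xy(1) by (auto simp: p_def q_def)
  \<comment> \<open>Multiplying the linear condition by \<open>x\<close> and using
    \<open>x * y = 1\<close> removes \<open>y\<close>; the remaining quadratic has the root
    \<open>1\<close>.\<close>
  have "(x - 1) * (p * x - q) = 0"
  proof -
    have "(p * x + q * y) * x = (p + q) * x" using pq(2) by simp
    then have "p * x * x + q * (x * y) = (p + q) * x" by (simp add: algebra_simps)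
    then show ?thesis using xy(3) by (simp add: algebra_simps)
  qed
  then consider "x = 1" | "p * x = q" by auto
  then have "x = 1"
  proof cases
    case 2
    then have px: "p * x = q" and qy: "q * y = p" using pq(2) by linarith+
    have "p \<noteq> 0" using px q by auto
    then have b2: "b2 > 0" using nonneg(1) by (auto simp: p_def less_le)
    have "p\<^sup>2 / b2 + q\<^sup>2 / b3 = 1 / 3"
    proof -
      have "p\<^sup>2 / b2 = b2 * c2\<^sup>2" "q\<^sup>2 / b3 = b3 * c3\<^sup>2"
        using b2 pos by (simp_all add: p_def q_def power2_eq_square)
      then show ?thesis using rk(2) by simp
    qed
    \<comment> \<open>In this case the weights exchange \<open>p\<close> and \<open>q\<close>, so
      the bushy condition also holds with the two swapped; the difference of both versions
      factors.\<close>
    moreover have "q\<^sup>2 / b2 + p\<^sup>2 / b3 = 1 / 3"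
    proof -
      have "q\<^sup>2 / b2 = b2 * c2\<^sup>2 * x\<^sup>2" unfolding px[symmetric] p_def using b2 by (simp add: power2_eq_square)
      moreover have "p\<^sup>2 / b3 = b3 * c3\<^sup>2 * y\<^sup>2" unfolding qy[symmetric] q_def using pos by (simp add: power2_eq_square)
      ultimately show ?thesis using xy(2) by simp
    qed
    ultimately have "(q\<^sup>2 - p\<^sup>2) * (b3 - b2) = 0"
      using b2 pos by (simp add: field_simps)
    then have "q\<^sup>2 = p\<^sup>2 \<or> b2 = b3" by auto
    moreover have "p > 0" using b2 pos by (simp add: p_def)
    ultimately have "q = p \<or> b2 = b3" using q power2_eq_iff_nonneg[of q p] by auto
    moreover have "q = p" if b: "b2 = b3"
    proof -
      have "b3 * (c2 * a) \<le> b3 * (c2 * c3)" using nonneg pos by (intro mult_left_mono) auto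
      then have "1 / 6 \<le> b3 * (c2 * c3)" using rk(3) by (simp add: mult_ac)
      \<comment> \<open>In the expanded square the bushy condition supplies \<open>1 / 3\<close>,
        and by the preceding bound the cross term is at least as large.\<close>
      moreover have "b3 * (c2 - c3)\<^sup>2 = 1 / 3 - 2 * (b3 * (c2 * c3))"
        using rk(2) unfolding b by (simp add: power2_eq_square algebra_simps)
      ultimately have "b3 * (c2 - c3)\<^sup>2 \<le> 0" by simp
      then have "c2 = c3" using pos by (simp add: mult_le_0_iff)
      then show ?thesis by (simp add: p_def q_def b)
    qed
    ultimately have "q = p" by blast
    with px \<open>p \<noteq> 0\<close> show ?thesis by simp
  qed
  with xy(3) show ?thesis by simp
qed

section \<open>Order conditions of the underlying scheme, and sufficiency for arbitrary
  parts\<close>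

lemma approx_const_const_iff: "approx (Suc k) (\<lambda>h. x) (\<lambda>h. y) \<longleftrightarrow> x = y"
  by (simp add: approx_def hO_const_Suc_iff)

lemma approx_limit_eq:
  assumes "approx (Suc k) f (\<lambda>h. l)" "(f \<longlongrightarrow> m) (at_right 0)"
  shows "m = l"
  using assms hO_imp_tendsto[of k f l] tendsto_unique[of "at_right (0::real)" f m l]
  by (simp add: approx_def)

text \<open>The tests for additive schemes apply with all weights equal to \<open>1\<close>, and
  what they show about constants up to \<open>O(h)\<close> holds exactly.\<close>

lemma rk_order_conditions:
  assumes rk: "explicit_rk 3 A c" and ord: "rk_order_at_least TYPE('n::finite) 3 3 A b"
  shows "b 1 + b 2 + b 3 = 1" "b 2 * c 2 + b 3 * c 3 = 1 / 2"
    "b 2 * (c 2)\<^sup>2 + b 3 * (c 3)\<^sup>2 = 1 / 3" "b 3 * A 3 2 * c 2 = 1 / 6"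
proof -
  note ord' = ord[unfolded rk_order_at_least_def]
  note cs = explicit_rk_3D[OF rk]
  have "approx (Suc 2) (\<lambda>h. b 1 + b 2 + b 3) (\<lambda>h. 1)"
    using additive_order_conditions(1)[OF ord'] by simp
  then show "b 1 + b 2 + b 3 = 1" by (simp only: approx_const_const_iff)
  have "approx (Suc 1) (\<lambda>h. b 2 * A 2 1 + b 3 * (A 3 1 + A 3 2)) (\<lambda>h. 1 / 2)"
    using additive_order_conditions(2)[OF ord'] by (simp add: numeral_2_eq_2)
  then show "b 2 * c 2 + b 3 * c 3 = 1 / 2" unfolding cs by (simp only: approx_const_const_iff)
  have "approx (Suc 0) (\<lambda>h. b 3 * A 3 2 * A 2 1) (\<lambda>h. 1 / 6)"
    using additive_order_conditions(3)[OF ord'] by simp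
  then show "b 3 * A 3 2 * c 2 = 1 / 6" unfolding cs by (simp only: approx_const_const_iff)
  have "approx (Suc 0) (\<lambda>h. b 2 * (A 2 1)\<^sup>2 + b 3 * (A 3 1 + A 3 2)\<^sup>2) (\<lambda>h. 1 / 3)"
    using additive_order_condition_bushy[OF ord'] by simp
  then show "b 2 * (c 2)\<^sup>2 + b 3 * (c 3)\<^sup>2 = 1 / 3" unfolding cs by (simp only: approx_const_const_iff)
qed

context weighted_step
begin

lemma local_error:
  assumes "ode_solution S (\<lambda>x. \<Sum>\<nu>\<in>UNIV. G \<nu> x) y t0 T" "y t0 = u"
    and "\<And>i \<nu>. i \<in> {2..3} \<Longrightarrow> approx 1 (W i \<nu>) (\<lambda>h. 1)" "\<And>\<nu>. approx 3 (V \<nu>) (\<lambda>h. 1)"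
    and "\<And>\<nu>. approx 2 (\<lambda>h. b 2 * c 2 * W 2 \<nu> h + b 3 * c 3 * W 3 \<nu> h) (\<lambda>h. 1 / 2)"
    and "(\<Sum>j=1..3. b j) = 1" "b 2 * (c 2)\<^sup>2 + b 3 * (c 3)\<^sup>2 = 1 / 3" "b 3 * A 3 2 * c 2 = 1 / 6"
  shows "approx 4 z (\<lambda>h. y (t0 + h))"
proof -
  have "approx 4 z (\<lambda>h. u + h *\<^sub>R F u + (h\<^sup>2 / 2) *\<^sub>R DF (F u) +
    h ^ 3 *\<^sub>R ((1 / 6) *\<^sub>R DF (DF (F u)) + (1 / 3) *\<^sub>R BF (F u) (F u)))"
    by (rule update_4[OF assms(3-8)])
  moreover have "approx 4 (\<lambda>h. y (t0 + h)) (\<lambda>h. u + h *\<^sub>R F u + (h\<^sup>2 / 2) *\<^sub>R DF (F u) +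
    h ^ 3 *\<^sub>R ((1 / 6) *\<^sub>R DF (DF (F u)) + (1 / 3) *\<^sub>R BF (F u) (F u)))"
    by (rule ode_solution_approx[OF assms(1)[folded F_def] taylor_F assms(2)])
  ultimately show ?thesis
    by (blast intro: approx_trans approx_sym)
qed

end

text \<open>The weights are frozen as functions of \<open>h\<close> while the split system is
  arbitrary, as in the second conjunct of \<open>mprk_order_at_least\<close>.\<close>

lemma additive_orderI:
  fixes W :: "nat \<Rightarrow> 'n::finite \<Rightarrow> real \<Rightarrow> real"
  assumes rk: "explicit_rk 3 A c"
    and W: "\<And>i \<nu>. i \<in> {2..3} \<Longrightarrow> approx 1 (W i \<nu>) (\<lambda>h. 1)" and V: "\<And>\<nu>. approx 3 (V \<nu>) (\<lambda>h. 1)"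
    and W_2: "\<And>\<nu>. approx 2 (\<lambda>h. b 2 * c 2 * W 2 \<nu> h + b 3 * c 3 * W 3 \<nu> h) (\<lambda>h. 1 / 2)"
    and bs: "(\<Sum>j=1..3. b j) = 1" "b 2 * (c 2)\<^sup>2 + b 3 * (c 3)\<^sup>2 = 1 / 3" "b 3 * A 3 2 * c 2 = 1 / 6"
  shows "additive_order_at_least 3 3 (\<lambda>h i j \<nu>. A i j * W i \<nu> h) (\<lambda>h j \<nu>. b j * V \<nu> h)"
  unfolding additive_order_at_least_def
proof (intro allI impI)
  fix G :: "'n \<Rightarrow> real^'n \<Rightarrow> real^'n" and u tn T U w
  assume smooth: "\<forall>\<nu>. C_k (3 + 1) UNIV (G \<nu>) \<and> lipschitz UNIV (G \<nu>)"
    and sol: "ode_solution UNIV (\<lambda>x. \<Sum>\<nu>\<in>UNIV. G \<nu> x) u tn T"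
    and step: "\<forall>\<^sub>F h in at_right 0. additive_step 3 (\<lambda>i j \<nu>. A i j * W i \<nu> h) (\<lambda>j \<nu>. b j * V \<nu> h) G (u tn) h (U h) (w h)"
  have "\<exists>B. taylor2 (G \<nu>) (u tn) (frechet_derivative (G \<nu>) (at (u tn))) B" for \<nu>
    using smooth by (intro C_k_imp_taylor2[of 1 UNIV]) (auto simp: eval_nat_numeral)
  then obtain B where B: "\<And>\<nu>. taylor2 (G \<nu>) (u tn) (frechet_derivative (G \<nu>) (at (u tn))) (B \<nu>)"
    by metis
  interpret weighted_step A b c G "\<lambda>\<nu>. frechet_derivative (G \<nu>) (at (u tn))" B "u tn" W V U w
    using rk B step W by unfold_locales (auto intro: approx_const_bounded)
  have "approx 4 w (\<lambda>h. u (tn + h))"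
    by (rule local_error[OF sol refl W V W_2 bs])
  then show "(\<lambda>h. norm (w h - u (tn + h))) \<in> O[at_right 0](\<lambda>h. h ^ (3 + 1))"
    by (simp add: approx_def hO_def)
qed

section \<open>MPRK schemes\<close>

locale mprk_run =
  fixes A :: "nat \<Rightarrow> nat \<Rightarrow> real" and b c :: "nat \<Rightarrow> real"
    and p d :: "'n::finite \<Rightarrow> 'n \<Rightarrow> real^'n \<Rightarrow> real"
    and \<rho> :: "nat \<Rightarrow> 'n \<Rightarrow> real^'n \<Rightarrow> (nat \<Rightarrow> real^'n) \<Rightarrow> real"
    and \<sigma> :: "'n \<Rightarrow> real^'n \<Rightarrow> (nat \<Rightarrow> real^'n) \<Rightarrow> real"
    and B and yn :: "real^'n" and Y :: "real \<Rightarrow> nat \<Rightarrow> real^'n" and z :: "real \<Rightarrow> real^'n"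
  assumes rk: "explicit_rk 3 A c"
    and pds: "pds p d"
    and taylor: "\<And>\<nu>. taylor2 (pds_part p d \<nu>) yn (frechet_derivative (pds_part p d \<nu>) (at yn)) (B \<nu>)"
    and rho: "\<And>i \<nu>. i \<in> {2..3} \<Longrightarrow> patankar_denominator (i - 1) (\<rho> i \<nu>)"
    and sigma: "\<And>\<nu>. patankar_denominator 3 (\<sigma> \<nu>)"
    and yn: "yn \<in> pos_orthant"
    and mprk: "\<forall>\<^sub>F h in at_right 0. mprk_step 3 A b p d \<rho> \<sigma> yn h (Y h) (z h)"
begin

lemma pos_near:
  assumes "approx 1 X (\<lambda>h. yn)"
  shows "(X \<longlongrightarrow> yn) (at_right 0)" "\<forall>\<^sub>F h in at_right 0. X h \<in> pos_orthant"
proof -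
  show "(X \<longlongrightarrow> yn) (at_right 0)"
    using assms by (intro hO_imp_tendsto[of 0]) (simp add: approx_def)
  then show "\<forall>\<^sub>F h in at_right 0. X h \<in> pos_orthant"
    by (rule topological_tendstoD[OF _ open_pos_orthant yn])
qed

text \<open>Conditional on the earlier stages only, so that it can be used inside the induction of
  \<open>stage_near\<close>, before all stages are known to converge.\<close>

lemma rho_tendsto_if:
  assumes "i \<in> {2..3}" "\<And>j. j \<in> {1..<i} \<Longrightarrow> approx 1 (\<lambda>h. Y h j) (\<lambda>h. yn)"
  shows "((\<lambda>h. \<rho> i \<nu> yn (Y h)) \<longlongrightarrow> \<rho> i \<nu> yn (\<lambda>_. yn)) (at_right 0)"
proof (rule patankar_denominator_tendsto[OF rho[OF assms(1)] yn])
  fix j assume "j \<in> {1..i - 1}"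
  then have "j \<in> {1..<i}" using assms(1) by auto
  then show "((\<lambda>h. Y h j) \<longlongrightarrow> yn) (at_right 0)"
    by (intro pos_near assms(2))
qed

text \<open>Earlier stages near \<open>yn\<close> are positive, which gives the additive form and
  the limits of the denominators; \<open>implicit_stage_approx\<close> then reaches the next
  stage.\<close>

lemma stage_near: "i \<in> {1..3} \<Longrightarrow> approx 1 (\<lambda>h. Y h i) (\<lambda>h. yn)"
proof (induction i rule: less_induct)
  case (less i)
  have near: "approx 1 (\<lambda>h. Y h j) (\<lambda>h. yn)" if "j \<in> {1..<i}" for j
    using that less by auto
  have "\<forall>\<^sub>F h in at_right 0. \<forall>j\<in>{1..<i}. Y h j \<in> pos_orthant"
    using pos_near(2)[OF near] by (intro eventually_ball_finite) auto
  with mprk have eq: "\<forall>\<^sub>F h in at_right 0. Y h i = yn + h *\<^sub>R (\<Sum>j=1..<i. \<Sum>\<nu>\<in>UNIV.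
      A i j *\<^sub>R ((Y h i $ \<nu> / \<rho> i \<nu> yn (Y h)) *\<^sub>R pds_part p d \<nu> (Y h j)))"
    by eventually_elim (rule mprk_stage_eq[OF _ pds less.prems], auto)
  show ?case
  proof (cases "i = 1")
    case True
    have "\<forall>\<^sub>F h in at_right 0. Y h i = yn"
      using eq by eventually_elim (simp add: True)
    then show ?thesis by (rule approx_eventually_eq)
  next
    case False
    then have i: "i \<in> {2..3}" using less.prems by auto
    show ?thesis
    proof (rule implicit_stage_approx[OF eq rho_tendsto_if[OF i near]])
      show "\<rho> i \<nu> yn (\<lambda>_. yn) \<noteq> 0" for \<nu>
        using patankar_denominator_pos[OF rho[OF i] yn, of \<nu>] by simp
      show "hO 0 (\<lambda>h. pds_part p d \<nu> (Y h j))" if "j \<in> {1..<i}" for j \<nu>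
        by (rule approx_const_bounded[OF taylor2_approx_1[OF taylor near[OF that]]])
    qed
  qed
qed

lemma stage_pos: "\<forall>\<^sub>F h in at_right 0. \<forall>j\<in>{1..3}. Y h j \<in> pos_orthant"
  using pos_near(2)[OF stage_near] by (intro eventually_ball_finite) auto

lemma rho_pos: "i \<in> {2..3} \<Longrightarrow> 0 < \<rho> i \<nu> yn (\<lambda>_. yn)"
  by (rule patankar_denominator_pos[OF rho yn])

lemma sigma_pos: "0 < \<sigma> \<nu> yn (\<lambda>_. yn)"
  by (rule patankar_denominator_pos[OF sigma yn])

lemma rho_tendsto:
  "i \<in> {2..3} \<Longrightarrow> ((\<lambda>h. \<rho> i \<nu> yn (Y h)) \<longlongrightarrow> \<rho> i \<nu> yn (\<lambda>_. yn)) (at_right 0)"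
  by (rule rho_tendsto_if, assumption, rule stage_near) auto

lemma sigma_tendsto: "((\<lambda>h. \<sigma> \<nu> yn (Y h)) \<longlongrightarrow> \<sigma> \<nu> yn (\<lambda>_. yn)) (at_right 0)"
  by (rule patankar_denominator_tendsto[OF sigma yn]) (intro pos_near stage_near)

text \<open>The denominators of the second stage depend on \<open>yn\<close> and the first stage only, so they do not
  vary with the step size. Hence \<open>W 2 \<nu> = 1 + O(h)\<close> as soon as \<open>W 2 \<nu>\<close> tends to \<open>1\<close>.\<close>

lemma rho_2_const: "\<forall>\<^sub>F h in at_right 0. \<rho> 2 \<nu> yn (Y h) = \<rho> 2 \<nu> yn (\<lambda>_. yn)"
proof -
  have "\<forall>\<^sub>F h in at_right 0. Y h 1 = yn"
    using mprk by eventually_elim (use mprk_stage_eq[OF _ pds, where i = 1 and s = 3] in fastforce)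
  then show ?thesis
  proof eventually_elim
    case (elim h)
    show ?case
      by (rule patankar_denominator_cong[OF rho]) (use elim in auto)
  qed
qed

lemma update_near: "approx 1 z (\<lambda>h. yn)"
proof (rule implicit_stage_approx[OF _ sigma_tendsto])
  show "\<forall>\<^sub>F h in at_right 0. z h = yn + h *\<^sub>R (\<Sum>j=1..3. \<Sum>\<nu>\<in>UNIV.
      b j *\<^sub>R ((z h $ \<nu> / \<sigma> \<nu> yn (Y h)) *\<^sub>R pds_part p d \<nu> (Y h j)))"
    using mprk stage_pos by eventually_elim (rule mprk_update_eq[OF _ pds], auto)
  show "\<sigma> \<nu> yn (\<lambda>_. yn) \<noteq> 0" for \<nu>
    using sigma_pos[of \<nu>] by simp
  show "hO 0 (\<lambda>h. pds_part p d \<nu> (Y h j))" if "j \<in> {1..3}" for j \<nu>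
    by (rule approx_const_bounded[OF taylor2_approx_1[OF taylor stage_near[OF that]]])
qed

section \<open>Weights versus denominators\<close>

definition W where "W i \<nu> h = Y h i $ \<nu> / \<rho> i \<nu> yn (Y h)"
definition V where "V \<nu> h = z h $ \<nu> / \<sigma> \<nu> yn (Y h)"

lemma W_tendsto:
  assumes "i \<in> {2..3}"
  shows "(W i \<nu> \<longlongrightarrow> yn $ \<nu> / \<rho> i \<nu> yn (\<lambda>_. yn)) (at_right 0)"
  unfolding W_def[abs_def] using assms rho_pos[OF assms, of \<nu>]
  by (intro tendsto_divide tendsto_vec_nth pos_near(1)[OF stage_near] rho_tendsto) auto

lemma V_tendsto: "(V \<nu> \<longlongrightarrow> yn $ \<nu> / \<sigma> \<nu> yn (\<lambda>_. yn)) (at_right 0)"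
  unfolding V_def[abs_def] using sigma_pos[of \<nu>]
  by (intro tendsto_divide tendsto_vec_nth pos_near(1)[OF update_near] sigma_tendsto) auto

sublocale weighted_step A b c "pds_part p d" "\<lambda>\<nu>. frechet_derivative (pds_part p d \<nu>) (at yn)" B yn W V Y z
proof
  show "\<forall>\<^sub>F h in at_right 0. additive_step 3 (\<lambda>i j \<nu>. A i j * W i \<nu> h) (\<lambda>j \<nu>. b j * V \<nu> h) (pds_part p d) yn h (Y h) (z h)"
    using mprk stage_pos
  proof eventually_elim
    case (elim h)
    show ?case
      unfolding additive_step_def
    proof (intro conjI ballI)
      fix i :: nat assume i: "i \<in> {1..3}"
      have "Y h i = yn + h *\<^sub>R (\<Sum>j=1..<i. \<Sum>\<nu>\<in>UNIV.
          A i j *\<^sub>R ((Y h i $ \<nu> / \<rho> i \<nu> yn (Y h)) *\<^sub>R pds_part p d \<nu> (Y h j)))"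
        by (rule mprk_stage_eq[OF elim(1) pds i]) (use elim(2) i in auto)
      then show "Y h i = yn + h *\<^sub>R (\<Sum>j=1..<i. \<Sum>\<nu>\<in>UNIV. (A i j * W i \<nu> h) *\<^sub>R pds_part p d \<nu> (Y h j))"
        by (simp only: W_def scaleR_scaleR)
    next
      have "z h = yn + h *\<^sub>R (\<Sum>j=1..3. \<Sum>\<nu>\<in>UNIV.
          b j *\<^sub>R ((z h $ \<nu> / \<sigma> \<nu> yn (Y h)) *\<^sub>R pds_part p d \<nu> (Y h j)))"
        by (rule mprk_update_eq[OF elim(1) pds]) (use elim(2) in auto)
      then show "z h = yn + h *\<^sub>R (\<Sum>j=1..3. \<Sum>\<nu>\<in>UNIV. (b j * V \<nu> h) *\<^sub>R pds_part p d \<nu> (Y h j))"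
        by (simp only: V_def scaleR_scaleR)
    qed
  qed
qed (auto intro: rk taylor tendsto_imp_hO[OF W_tendsto])

lemma F_eq: "F x = pds_rhs p d x"
  by (simp add: F_def pds_rhs_def)

lemma NB2_eq: "NB2 p d h yn = yn + h *\<^sub>R F yn + (h\<^sup>2 / 2) *\<^sub>R DF (F yn)"
  by (simp add: NB2_def F_def DF_def linear_sum[OF bounded_linear.linear[OF D_linear]])

text \<open>\<open>hO_quotient\<close> turns the ratio into a difference, in which
  \<open>Y h i\<close> may be replaced by \<open>yn\<close> at first order.\<close>

lemma W_iff:
  assumes "i \<in> {2..3}"
  shows "approx 1 (W i \<nu>) (\<lambda>h. 1) \<longleftrightarrow> hO 1 (\<lambda>h. \<rho> i \<nu> yn (Y h) - yn $ \<nu>)"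
proof -
  have "approx 1 (W i \<nu>) (\<lambda>h. 1) \<longleftrightarrow> hO 1 (\<lambda>h. Y h i $ \<nu> - \<rho> i \<nu> yn (Y h))"
    unfolding approx_def W_def
    using rho_tendsto[OF assms] rho_pos[OF assms, of \<nu>] by (intro hO_quotient) auto
  moreover
  have Y: "hO 1 (\<lambda>h. Y h i $ \<nu> - yn $ \<nu>)"
    using hO_component[of 1 "\<lambda>h. Y h i - yn" \<nu>] stage_near[of i] assms by (simp add: approx_def)
  have "hO 1 (\<lambda>h. Y h i $ \<nu> - \<rho> i \<nu> yn (Y h)) \<longleftrightarrow> hO 1 (\<lambda>h. \<rho> i \<nu> yn (Y h) - yn $ \<nu>)"
  proof
    assume "hO 1 (\<lambda>h. Y h i $ \<nu> - \<rho> i \<nu> yn (Y h))"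
    from hO_trans[OF hO_diff_swap[OF this] Y] show "hO 1 (\<lambda>h. \<rho> i \<nu> yn (Y h) - yn $ \<nu>)" .
  next
    assume "hO 1 (\<lambda>h. \<rho> i \<nu> yn (Y h) - yn $ \<nu>)"
    from hO_trans[OF Y hO_diff_swap[OF this]] show "hO 1 (\<lambda>h. Y h i $ \<nu> - \<rho> i \<nu> yn (Y h))" .
  qed
  ultimately show ?thesis by blast
qed

lemma V_iff: "approx k (V \<nu>) (\<lambda>h. 1) \<longleftrightarrow> hO k (\<lambda>h. z h $ \<nu> - \<sigma> \<nu> yn (Y h))"
  unfolding approx_def V_def
  using sigma_tendsto[of \<nu>] sigma_pos[of \<nu>] by (intro hO_quotient) auto

context
  assumes W_1: "\<And>i \<nu>. i \<in> {2..3} \<Longrightarrow> approx 1 (W i \<nu>) (\<lambda>h. 1)"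
begin

text \<open>The two numerators agree up to \<open>O(h^2)\<close> by \<open>stage_2\<close>, which
  rests on \<open>W_1\<close>; the condition on each single denominator must therefore be available
  before the weighted sum is translated.\<close>

lemma weights_iff:
  "approx 2 (\<lambda>h. b 2 * c 2 * W 2 \<nu> h + b 3 * c 3 * W 3 \<nu> h) (\<lambda>h. 1 / 2) \<longleftrightarrow>
   hO 2 (\<lambda>h. (\<Sum>i=2..3. b i * c i * ((yn $ \<nu> + h * c i * pds_rhs p d yn $ \<nu>) / \<rho> i \<nu> yn (Y h))) - 1 / 2)"
proof -
  define R where "R i h = (yn $ \<nu> + h * c i * pds_rhs p d yn $ \<nu>) / \<rho> i \<nu> yn (Y h)" for i h
  have W_R: "approx 2 (W i \<nu>) (R i)" if i: "i \<in> {2..3}" for i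
  proof -
    have "approx 2 (\<lambda>h. Y h i) (\<lambda>h. yn + h *\<^sub>R (c i *\<^sub>R F yn))"
      using i by (intro stage_2 W_1) auto
    then have "hO 2 (\<lambda>h. (Y h i - (yn + h *\<^sub>R (c i *\<^sub>R F yn))) $ \<nu>)"
      unfolding approx_def by (rule hO_component)
    moreover have "hO 0 (\<lambda>h. inverse (\<rho> i \<nu> yn (Y h)))"
      using tendsto_imp_hO[OF tendsto_inverse[OF rho_tendsto[OF i, of \<nu>]]] rho_pos[OF i, of \<nu>] by simp
    ultimately have "hO 2 (\<lambda>h. (Y h i - (yn + h *\<^sub>R (c i *\<^sub>R F yn))) $ \<nu> * inverse (\<rho> i \<nu> yn (Y h)))"
      by (rule hO_mult_bounded)
    then show ?thesis
      by (simp add: approx_def W_def R_def F_eq divide_inverse algebra_simps)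
  qed
  have "approx 2 (\<lambda>h. (b 2 * c 2) *\<^sub>R W 2 \<nu> h + (b 3 * c 3) *\<^sub>R W 3 \<nu> h) (\<lambda>h. (b 2 * c 2) *\<^sub>R R 2 h + (b 3 * c 3) *\<^sub>R R 3 h)"
    by (intro approx_add approx_cscale W_R) auto
  then have *: "approx 2 (\<lambda>h. b 2 * c 2 * W 2 \<nu> h + b 3 * c 3 * W 3 \<nu> h) (\<lambda>h. b 2 * c 2 * R 2 h + b 3 * c 3 * R 3 h)"
    by simp
  have "(\<lambda>h. (\<Sum>i=2..3. b i * c i * ((yn $ \<nu> + h * c i * pds_rhs p d yn $ \<nu>) / \<rho> i \<nu> yn (Y h))) - 1 / 2) =
      (\<lambda>h. (b 2 * c 2 * R 2 h + b 3 * c 3 * R 3 h) - 1 / 2)"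
    unfolding stage_sets by (simp add: R_def)
  then show ?thesis
    using approx_trans[OF * , of "\<lambda>h. 1 / 2"] approx_trans[OF approx_sym[OF *], of "\<lambda>h. 1 / 2"]
    unfolding approx_def by auto
qed

context
  assumes bs: "(\<Sum>j=1..3. b j) = 1" "b 2 * c 2 + b 3 * c 3 = 1 / 2"
begin

lemma V_imp_sigma:
  assumes V: "\<And>\<nu>. approx 3 (V \<nu>) (\<lambda>h. 1)"
  shows "hO 3 (\<lambda>h. \<sigma> \<nu> yn (Y h) - NB2 p d h yn $ \<nu>)"
proof -
  have V2: "approx 2 (V \<mu>) (\<lambda>h. 1)" for \<mu>
    using V by (rule approx_mono) simp
  have z: "hO 3 (\<lambda>h. (z h - NB2 p d h yn) $ \<nu>)"
    using update_3[OF W_1 V2 bs] unfolding approx_def NB2_eq by (rule hO_component)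
  have "hO 3 (\<lambda>h. z h $ \<nu> - \<sigma> \<nu> yn (Y h))"
    using V V_iff by blast
  from hO_trans[OF hO_diff_swap[OF this] z[unfolded vector_minus_component]] show ?thesis .
qed

text \<open>The expansion of \<open>z\<close> needs \<open>V\<close>, while \<open>V\<close> is
  judged by comparing \<open>z\<close> with \<open>NB2\<close>. The linearly implicit estimate
  behind \<open>update_near\<close> breaks this circle.\<close>

lemma sigma_imp_V:
  assumes S: "\<And>\<nu>. hO 3 (\<lambda>h. \<sigma> \<nu> yn (Y h) - NB2 p d h yn $ \<nu>)"
  shows "approx 3 (V \<nu>) (\<lambda>h. 1)"
proof -
  have V_if: "approx k (V \<nu>) (\<lambda>h. 1)" if z: "approx k z (\<lambda>h. NB2 p d h yn)" and k: "k \<le> 3" for k \<nu>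
  proof -
    have "hO k (\<lambda>h. (z h - NB2 p d h yn) $ \<nu>)"
      using z unfolding approx_def by (rule hO_component)
    then have "hO k (\<lambda>h. z h $ \<nu> - NB2 p d h yn $ \<nu>)" by simp
    then show ?thesis
      unfolding V_iff using hO_diff_swap[OF hO_mono[OF S k]] by (rule hO_trans)
  qed
  have NB2_2: "approx 2 (\<lambda>h. yn + h *\<^sub>R F yn) (\<lambda>h. NB2 p d h yn)"
  proof -
    have "hO (2 + 0) (\<lambda>h. h\<^sup>2 *\<^sub>R ((- 1 / 2) *\<^sub>R DF (F yn)))"
      by (rule hO_scaleR[OF hO_power hO_const])
    then show ?thesis by (simp add: approx_def NB2_eq)
  qed
  have "hO (1 + 0) (\<lambda>h. h *\<^sub>R (- F yn))"
    by (rule hO_scaleR[OF hO_id(1) hO_const])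
  then have "approx 1 (\<lambda>h. yn) (\<lambda>h. yn + h *\<^sub>R F yn)"
    by (simp add: approx_def)
  from approx_trans[OF update_near approx_trans[OF this approx_mono[OF NB2_2]]]
  have "approx 1 z (\<lambda>h. NB2 p d h yn)" by simp
  then have V1: "approx 1 (V \<nu>) (\<lambda>h. 1)" for \<nu> by (rule V_if) simp
  have "approx 2 z (\<lambda>h. NB2 p d h yn)"
    by (rule approx_trans[OF update_2[OF V1 bs(1)] NB2_2])
  then have V2: "approx 2 (V \<nu>) (\<lambda>h. 1)" for \<nu> by (rule V_if) simp
  have "approx 3 z (\<lambda>h. NB2 p d h yn)"
    using update_3[OF W_1 V2 bs] unfolding NB2_eq .
  then show ?thesis by (rule V_if) simp
qed

end

end

lemma order_imp_weights:
  assumes ord: "additive_order_at_least 3 3 (\<lambda>h i j \<nu>. A i j * W i \<nu> h) (\<lambda>h j \<nu>. b j * V \<nu> h)"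
    and nonneg: "\<forall>i\<in>{1..3}. \<forall>j\<in>{1..3}. 0 \<le> A i j" "\<forall>j\<in>{1..3}. 0 \<le> b j"
    and bs: "b 1 + b 2 + b 3 = 1" "b 2 * c 2 + b 3 * c 3 = 1 / 2"
      "b 2 * (c 2)\<^sup>2 + b 3 * (c 3)\<^sup>2 = 1 / 3" "b 3 * A 3 2 * c 2 = 1 / 6"
  shows "approx 3 (V \<nu>) (\<lambda>h. 1)"
    and "approx 2 (\<lambda>h. b 2 * c 2 * W 2 \<nu> h + b 3 * c 3 * W 3 \<nu> h) (\<lambda>h. 1 / 2)"
    and "approx 1 (W 2 \<nu>) (\<lambda>h. 1)" and "approx 1 (W 3 \<nu>) (\<lambda>h. 1)"
proof -
  note cs = explicit_rk_3D[OF rk]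
  have stages: "(2::nat) \<in> {2..3}" "(3::nat) \<in> {2..3}" by auto
  have "(\<lambda>h. b 1 * V \<nu> h + b 2 * V \<nu> h + b 3 * V \<nu> h) = (\<lambda>h. (b 1 + b 2 + b 3) * V \<nu> h)"
    by (simp add: algebra_simps)
  then show V3: "approx 3 (V \<nu>) (\<lambda>h. 1)"
    using additive_order_conditions(1)[OF ord, of \<nu>] unfolding bs(1) by simp
  \<comment> \<open>With \<open>V \<nu> = 1 + O(h^3)\<close> already known, the common factor
    \<open>V \<nu>\<close> drops out of the remaining conditions.\<close>
  have cancel_V: "approx k f (\<lambda>h. l)" if "approx k (\<lambda>h. V \<nu> h * f h) (\<lambda>h. l)" "k \<le> 3" "hO 0 f" for k l f
  proof -
    have "approx k (\<lambda>h. V \<nu> h *\<^sub>R f h) (\<lambda>h. 1 *\<^sub>R f h)"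
      using approx_mono[OF V3 that(2)] approx_refl hO_const that(3) by (rule approx_scaleR)
    then have "approx k f (\<lambda>h. V \<nu> h * f h)" by (simp add: approx_sym)
    with that(1) show ?thesis by (blast intro: approx_trans)
  qed
  note Wb = W_bounded[OF stages(1)] W_bounded[OF stages(2)]
  have W2: "approx 2 (\<lambda>h. V \<nu> h * (b 2 * c 2 * W 2 \<nu> h + b 3 * c 3 * W 3 \<nu> h)) (\<lambda>h. 1 / 2)"
    using additive_order_conditions(2)[OF ord, of \<nu>] unfolding cs by (simp add: algebra_simps)
  then show S2: "approx 2 (\<lambda>h. b 2 * c 2 * W 2 \<nu> h + b 3 * c 3 * W 3 \<nu> h) (\<lambda>h. 1 / 2)"
    by (rule cancel_V) (auto intro!: hO_add hO_cmult Wb)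
  have WW: "hO 0 (\<lambda>h. W 2 \<nu> h * W 3 \<nu> h)"
    using hO_mult[OF Wb] by simp
  have "approx 1 (\<lambda>h. V \<nu> h * ((b 3 * A 3 2 * c 2) * (W 2 \<nu> h * W 3 \<nu> h))) (\<lambda>h. 1 / 6)"
    using additive_order_conditions(3)[OF ord, of \<nu>] unfolding cs by (simp add: mult_ac)
  then have "approx 1 (\<lambda>h. (1 / 6) * (W 2 \<nu> h * W 3 \<nu> h)) (\<lambda>h. 1 / 6)"
    unfolding bs(4) by (rule cancel_V) (simp, rule hO_cmult[OF WW])
  from approx_cscale[OF this, of 6] have S3: "approx 1 (\<lambda>h. W 2 \<nu> h * W 3 \<nu> h) (\<lambda>h. 1)"
    by simp
  define P where "P = (\<lambda>h. b 2 * (c 2)\<^sup>2 * (W 2 \<nu> h)\<^sup>2 + b 3 * (c 3)\<^sup>2 * (W 3 \<nu> h)\<^sup>2)"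
  have AW: "hO 0 (\<lambda>h. A i j * W i \<nu> h)" if "i \<in> {2..3}" for i j
    by (intro hO_cmult W_bounded that)
  have bV: "hO 0 (\<lambda>h. b j * V \<nu> h)" for j
    by (intro hO_cmult tendsto_imp_hO[OF V_tendsto])
  have Pb: "hO 0 P"
    unfolding P_def power2_eq_square using hO_mult[OF Wb(1) Wb(1)] hO_mult[OF Wb(2) Wb(2)]
    by (intro hO_add hO_cmult) simp_all
  have "approx 1 (\<lambda>h. V \<nu> h * P h) (\<lambda>h. 1 / 3)"
    using additive_order_condition_bushy[OF ord AW[OF stages(1)] AW[OF stages(2)] AW[OF stages(2)] bV bV]
    unfolding P_def cs by (simp add: algebra_simps power2_eq_square)
  then have S4: "approx 1 P (\<lambda>h. 1 / 3)"
    by (rule cancel_V) (auto intro: Pb)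
  \<comment> \<open>Passing to the limit turns conditions on functions of \<open>h\<close> into
    polynomial equations for two numbers.\<close>
  define x where "x = yn $ \<nu> / \<rho> 2 \<nu> yn (\<lambda>_. yn)"
  define y where "y = yn $ \<nu> / \<rho> 3 \<nu> yn (\<lambda>_. yn)"
  have lim: "(W 2 \<nu> \<longlongrightarrow> x) (at_right 0)" "(W 3 \<nu> \<longlongrightarrow> y) (at_right 0)"
    using W_tendsto[OF stages(1)] W_tendsto[OF stages(2)] by (auto simp: x_def y_def)
  have "b 2 * c 2 * x + b 3 * c 3 * y = 1 / 2"
    by (rule approx_limit_eq[OF approx_mono[OF S2, of "Suc 0"]]) (simp, intro tendsto_intros lim)
  moreover have "x * y = 1"
    by (rule approx_limit_eq[OF S3[unfolded One_nat_def]]) (intro tendsto_intros lim)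
  moreover have "b 2 * (c 2)\<^sup>2 * x\<^sup>2 + b 3 * (c 3)\<^sup>2 * y\<^sup>2 = 1 / 3"
    by (rule approx_limit_eq[OF S4[unfolded One_nat_def]]) (unfold P_def, intro tendsto_intros lim)
  moreover have "0 \<le> b 2" "0 \<le> b 3" "0 \<le> c 2" "0 \<le> A 3 2" "A 3 2 \<le> c 3"
    using nonneg unfolding cs by auto
  ultimately have xy: "x = 1" "y = 1"
    using weight_limits_eq_1[of "b 2" "b 3" "c 2" "A 3 2" "c 3" x y] bs(2-4) by auto
  have "yn $ \<nu> = \<rho> 2 \<nu> yn (\<lambda>_. yn)"
    using xy(1) rho_pos[OF stages(1), of \<nu>] by (simp add: x_def)
  then have "\<forall>\<^sub>F h in at_right 0. \<rho> 2 \<nu> yn (Y h) - yn $ \<nu> = 0"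
    using rho_2_const[of \<nu>] by simp
  then show W21: "approx 1 (W 2 \<nu>) (\<lambda>h. 1)"
    unfolding W_iff[OF stages(1)] by (rule hO_eqI[OF hO_zero])
  \<comment> \<open>\<open>\<rho> 3\<close> may vary with the second stage, so the limit
    \<open>1\<close> of \<open>W 3 \<nu>\<close> comes without a rate; the rate is inherited from
    \<open>W 2 \<nu>\<close> through the product condition.\<close>
  have "hO 1 (\<lambda>h. W 2 \<nu> h * W 3 \<nu> h - W 3 \<nu> h)"
  proof -
    have "approx 1 (\<lambda>h. W 2 \<nu> h *\<^sub>R W 3 \<nu> h) (\<lambda>h. 1 *\<^sub>R W 3 \<nu> h)"
      using W21 approx_refl hO_const Wb(2) by (rule approx_scaleR)
    then show ?thesis by (simp add: approx_def)
  qed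
  with S3 show "approx 1 (W 3 \<nu>) (\<lambda>h. 1)"
    using approx_sym approx_trans unfolding approx_def[symmetric] by blast
qed

end

theorem theorem19:
  fixes A :: "nat \<Rightarrow> nat \<Rightarrow> real" and b c :: "nat \<Rightarrow> real"
    and p d :: "'n::finite \<Rightarrow> 'n \<Rightarrow> real^'n \<Rightarrow> real"
    and \<rho> :: "nat \<Rightarrow> 'n \<Rightarrow> real^'n \<Rightarrow> (nat \<Rightarrow> real^'n) \<Rightarrow> real"
    and \<sigma> :: "'n \<Rightarrow> real^'n \<Rightarrow> (nat \<Rightarrow> real^'n) \<Rightarrow> real"
  assumes "explicit_rk 3 A c"
    and "rk_order_at_least TYPE('n) 3 3 A b"
    and "\<forall>i\<in>{1..3}. \<forall>j\<in>{1..3}. 0 \<le> A i j" and "\<forall>j\<in>{1..3}. 0 \<le> b j"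
    and "pds p d"
    and "\<forall>\<nu>. C_k 4 pos_orthant (pds_part p d \<nu>)"
    and "\<forall>\<nu>. lipschitz pos_orthant (pds_part p d \<nu>)"
    and "\<forall>i\<in>{2..3}. \<forall>\<nu>. patankar_denominator (i - 1) (\<rho> i \<nu>)"
    and "\<forall>\<nu>. patankar_denominator 3 (\<sigma> \<nu>)"
  shows "mprk_order_at_least 3 3 A b p d \<rho> \<sigma> \<longleftrightarrow>
    (\<forall>yn\<in>pos_orthant. \<forall>Y z.
       (\<forall>\<^sub>F h in at_right 0. mprk_step 3 A b p d \<rho> \<sigma> yn h (Y h) (z h)) \<longrightarrow>
       (\<forall>\<mu>. (\<lambda>h. \<sigma> \<mu> yn (Y h) - NB2 p d h yn $ \<mu>) \<in> O[at_right 0](\<lambda>h. h ^ 3)) \<and>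
       (\<forall>\<nu>. (\<lambda>h. (\<Sum>i=2..3. b i * c i * ((yn $ \<nu> + h * c i * pds_rhs p d yn $ \<nu>) / \<rho> i \<nu> yn (Y h))) - 1 / 2)
              \<in> O[at_right 0](\<lambda>h. h ^ 2)) \<and>
       (\<forall>\<nu>. \<forall>i\<in>{2..3}. (\<lambda>h. \<rho> i \<nu> yn (Y h) - yn $ \<nu>) \<in> O[at_right 0](\<lambda>h. h)))"
proof -
  note bs = rk_order_conditions[OF assms(1,2)]
  have bs_sum: "(\<Sum>j=1..3. b j) = 1"
    unfolding stage_sets using bs(1) by simp
  \<comment> \<open>Both sides of the theorem quantify over the same starting values and families of
    steps, so the equivalence is proved for each of them separately.\<close>
  have run: "((\<forall>y tn T. ode_solution pos_orthant (pds_rhs p d) y tn T \<longrightarrow> y tn = yn \<longrightarrow>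
           (\<lambda>h. norm (z h - y (tn + h))) \<in> O[at_right 0](\<lambda>h. h ^ (3 + 1))) \<and>
        additive_order_at_least 3 3
          (\<lambda>h i j \<nu>. A i j * (Y h i $ \<nu> / \<rho> i \<nu> yn (Y h)))
          (\<lambda>h j \<nu>. b j * (z h $ \<nu> / \<sigma> \<nu> yn (Y h)))) \<longleftrightarrow>
       (\<forall>\<mu>. (\<lambda>h. \<sigma> \<mu> yn (Y h) - NB2 p d h yn $ \<mu>) \<in> O[at_right 0](\<lambda>h. h ^ 3)) \<and>
       (\<forall>\<nu>. (\<lambda>h. (\<Sum>i=2..3. b i * c i * ((yn $ \<nu> + h * c i * pds_rhs p d yn $ \<nu>) / \<rho> i \<nu> yn (Y h))) - 1 / 2)
              \<in> O[at_right 0](\<lambda>h. h ^ 2)) \<and>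
       (\<forall>\<nu>. \<forall>i\<in>{2..3}. (\<lambda>h. \<rho> i \<nu> yn (Y h) - yn $ \<nu>) \<in> O[at_right 0](\<lambda>h. h))"
    (is "?error \<and> ?order \<longleftrightarrow> ?sigma \<and> ?sum \<and> ?rho")
    if yn: "yn \<in> pos_orthant"
      and step: "\<forall>\<^sub>F h in at_right 0. mprk_step 3 A b p d \<rho> \<sigma> yn h (Y h) (z h)" for yn Y z
  proof -
    have "\<exists>B. taylor2 (pds_part p d \<nu>) yn (frechet_derivative (pds_part p d \<nu>) (at yn)) B" for \<nu>
      using assms(6) by (intro C_k_imp_taylor2[OF _ open_pos_orthant yn, of 1]) (simp add: eval_nat_numeral)
    then obtain B where "\<And>\<nu>. taylor2 (pds_part p d \<nu>) yn (frechet_derivative (pds_part p d \<nu>) (at yn)) (B \<nu>)"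
      by metis
    then interpret mprk_run A b c p d \<rho> \<sigma> B yn Y z
      using assms(1,5,8,9) yn step by unfold_locales auto
    have order: "?order \<longleftrightarrow> additive_order_at_least 3 3 (\<lambda>h i j \<nu>. A i j * W i \<nu> h) (\<lambda>h j \<nu>. b j * V \<nu> h)"
      by (simp only: W_def V_def)
    have rho_iff: "?rho \<longleftrightarrow> (\<forall>\<nu>. \<forall>i\<in>{2..3}. approx 1 (W i \<nu>) (\<lambda>h. 1))"
      by (simp add: W_iff hO_real_iff del: One_nat_def)
    have sum_iff: "?sum \<longleftrightarrow> (\<forall>\<nu>. approx 2 (\<lambda>h. b 2 * c 2 * W 2 \<nu> h + b 3 * c 3 * W 3 \<nu> h) (\<lambda>h. 1 / 2))"
      if "\<And>i \<nu>. i \<in> {2..3} \<Longrightarrow> approx 1 (W i \<nu>) (\<lambda>h. 1)"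
      by (simp only: weights_iff[OF that] hO_real_iff)
    show ?thesis
    proof
      assume "?error \<and> ?order"
      \<comment> \<open>The weights are recovered from the conjunct with arbitrary parts, where the
        elementary differentials are separated.\<close>
      then have ord: "additive_order_at_least 3 3 (\<lambda>h i j \<nu>. A i j * W i \<nu> h) (\<lambda>h j \<nu>. b j * V \<nu> h)"
        using order by blast
      note conds = order_imp_weights[OF ord assms(3,4) bs]
      have W: "approx 1 (W i \<nu>) (\<lambda>h. 1)" if "i \<in> {2..3}" for i \<nu>
        using that conds(3,4)[of \<nu>] unfolding stage_sets by auto
      have ?sigma
        using V_imp_sigma[OF W bs_sum bs(2) conds(1)] by (simp add: hO_real_iff)
      moreover have ?sum using sum_iff[OF W] conds(2) by blast
      moreover have ?rho using rho_iff W by blast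
      ultimately show "?sigma \<and> ?sum \<and> ?rho" by blast
    next
      assume *: "?sigma \<and> ?sum \<and> ?rho"
      then have W: "approx 1 (W i \<nu>) (\<lambda>h. 1)" if "i \<in> {2..3}" for i \<nu>
        using that rho_iff by blast
      have sum: "approx 2 (\<lambda>h. b 2 * c 2 * W 2 \<nu> h + b 3 * c 3 * W 3 \<nu> h) (\<lambda>h. 1 / 2)" for \<nu>
        using * sum_iff[OF W] by blast
      have V: "approx 3 (V \<nu>) (\<lambda>h. 1)" for \<nu>
        by (rule sigma_imp_V[OF W bs_sum bs(2)]) (use * in \<open>simp_all add: hO_real_iff\<close>)
      have "additive_order_at_least 3 3 (\<lambda>h i j \<nu>. A i j * W i \<nu> h) (\<lambda>h j \<nu>. b j * V \<nu> h)"
        by (rule additive_orderI[OF assms(1) W V sum bs_sum bs(3,4)])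
      then have ?order using order by blast
      moreover have ?error
      proof (intro allI impI)
        fix y tn T assume sol: "ode_solution pos_orthant (pds_rhs p d) y tn T" "y tn = yn"
        have "approx 4 z (\<lambda>h. y (tn + h))"
          by (rule local_error[OF sol(1)[unfolded pds_rhs_def[abs_def]] sol(2) W V sum bs_sum bs(3,4)])
        then show "(\<lambda>h. norm (z h - y (tn + h))) \<in> O[at_right 0](\<lambda>h. h ^ (3 + 1))"
          by (simp add: approx_def hO_def)
      qed
      ultimately show "?error \<and> ?order" by blast
    qed
  qed
  show ?thesis
    unfolding mprk_order_at_least_def
    by (intro ball_cong[OF refl] arg_cong[where f = All] ext imp_cong[OF refl] run)
qed

end
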